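(* Let $\{x^k\}_{k\ge 0}$ be an infinite sequence generated by the FITS$^3$ iteration (defined in the context, with the inexactness level $\varepsilon\in[0,1)$) applied to $\mathcal{E}(x)=\frac12\|Ax-b\|_2^2+\alpha\sum_{g_i\in\mathcal{G}}\psi(\|x_{g_i}\|_p)$, with $\beta>\|A^\top A\|_2$ and extrapolation parameters $\{t_k\}\subset[0,\bar t)$ satisfying $\sup_k t_k<\bar t$. Assume that the function $\mathcal{H}:\mathbb{R}^n\times\mathbb{R}^n\to\mathbb{R}$, $\mathcal{H}(x,u)=\mathcal{E}(x)+\frac{\beta(1-\varepsilon)}{2}\|x-u\|_2^2$, is a Kurdyka–Łojasiewicz (KL) function. Then the whole sequence $\{x^k\}$ converges to a stationary point of $\mathcal{E}$, i.e. to a point $\bar x$ with $0\in\partial\mathcal{E}(\bar x)$. Moreover, $\sum_{k=0}^\infty\|x^k-x^{k-1}\|_2<\infty$ (where $x^{-1}=x^0$).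
   Context: Problem. $A\in\mathbb{R}^{m\times n}$ ($m<n$) is a nonzero matrix, $b\in\mathbb{R}^m$, $b\ne0$, $\alpha>0$, $p\in[1,+\infty)$. $\mathcal{G}=\{g_1,\dots,g_r\}$ is a partition of $\{1,\dots,n\}$ into nonempty blocks of consecutive indices (groups); $x_{g_i}$ is the subvector of $x\in\mathbb{R}^n$ with indices in $g_i$. For $\mathcal{T}\subseteq\mathcal{G}$, $x_{\mathcal{T}}$ is the subvector of $x$ with indices in the groups of $\mathcal{T}$. The group support is $\mathcal{S}(x)=\{g_i\in\mathcal{G}:x_{g_i}\neq0\}$. Assumptions on $\psi:[0,\infty)\to[0,\infty)$: $\psi$ is concave, $\psi(0)=0$, $\psi$ is coercive ($\psi(t)\to+\infty$ as $t\to+\infty$), $\psi$ is $C^2$ on $(0,\infty)$, $\psi'(0+)=+\infty$, and $\psi''$ is increasing on $(0,\infty)$. $\partial$ denotes the limiting (Mordukhovich) subdifferential (which is the usual one for convex functions). $\|M\|_2$ is the spectral norm of a matrix $M$. FITS$^3$ iteration. Fix $\beta>\|A^\top A\|_2$, a threshold $\tau>0$, $\varepsilon\in[0,1)$, and put $$\bar t=\frac{\sqrt{(\beta+\|A^\top A\|_2)^2-4\beta\varepsilon\|A^\top A\|_2}-(\beta-\|A^\top A\|_2)}{2\|A^\top A\|_2}\in(0,1].$$ Take $x^0\in\mathbb{R}^n$, $x^{-1}=\tilde x^{-1}=x^0$, and $\{t_k\}\subset[0,\bar t)$ with $\sup_kt_k<\bar t$. For $k=0,1,2,\dots$: (1)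 $\tilde x^k_{g_i}=x^k_{g_i}$ if $\|x^k_{g_i}\|_p\ge\tau$, and $\tilde x^k_{g_i}=0$ otherwise; $\tilde{\mathcal{S}}^k=\mathcal{S}(\tilde x^k)$. (2) $z^k_{\tilde{\mathcal{S}}^k}=\tilde x^k_{\tilde{\mathcal{S}}^k}+t_k(\tilde x^k_{\tilde{\mathcal{S}}^k}-\tilde x^{k-1}_{\tilde{\mathcal{S}}^k})$ and $z^k_{g_i}=0$ for $g_i\in\mathcal{G}\setminus\tilde{\mathcal{S}}^k$. (3) $x^{k+1}_{g_i}=0$ for $g_i\in\mathcal{G}\setminus\tilde{\mathcal{S}}^k$; for $g_i\in\tilde{\mathcal{S}}^k$, $x^{k+1}_{g_i}$ is an approximate minimizer of the strongly convex function $$\mathcal{J}^k_{g_i}(w)=(w-z^k_{g_i})^\top(A^\top(Az^k-b))_{g_i}+\tfrac{\beta}{2}\|w-z^k_{g_i}\|_2^2+\alpha\big[\psi(\|\tilde x^k_{g_i}\|_p)+\psi'(\|\tilde x^k_{g_i}\|_p)(\|w\|_p-\|\tilde x^k_{g_i}\|_p)\big]$$ in the sense that there exists $\lambda^{k+1}_{g_i}\in\partial\mathcal{J}^k_{g_i}(x^{k+1}_{g_i})$ with $\|\lambda^{k+1}_{g_i}\|_2\le\frac{\beta\varepsilon}{2}\|x^{k+1}_{g_i}-\tilde x^k_{g_i}\|_2$ (exact minimization if $\varepsilon=0$). KL function: a function $f:\mathbb{R}^N\to\mathbb{R}\cup\{+\infty\}$ (proper, lower semicontinuous) has the KL property at $\bar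 v\in\operatorname{dom}\partial f$ if there exist $\sigma\in(0,+\infty]$, a neighborhood $U$ of $\bar v$ and a continuous concave function $\varphi:[0,\sigma)\to[0,\infty)$ with $\varphi(0)=0$, $\varphi\in C^1(0,\sigma)$, $\varphi'>0$ on $(0,\sigma)$, such that $\varphi'(f(v)-f(\bar v))\,\operatorname{dist}(0,\partial f(v))\ge1$ for all $v\in U$ with $f(\bar v)<f(v)<f(\bar v)+\sigma$. $f$ is a KL function if it has the KL property at every point of $\operatorname{dom}\partial f$. *)

theory Defs
  imports "HOL-Analysis.Analysis" "HOL-Library.Disjoint_Sets"
begin

section \<open>Limiting subdifferential and the Kurdyka--Lojasiewicz property\<close>

text \<open>
  The subdifferentials carry the ambient linear subspace \<open>V\<close> as a parameter, because the
  subproblems of the algorithm live on the coordinate space of one group of variables,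
  whose dimension depends on the group. Functions are understood to be
  \<open>\<real> \<union> {+\<infinity>}\<close>-valued; no subgradients exist outside the effective domain.
\<close>

definition frechet_subdiff_on ::
    "'a::euclidean_space set \<Rightarrow> ('a \<Rightarrow> ereal) \<Rightarrow> 'a \<Rightarrow> 'a set" where
  "frechet_subdiff_on V f x =
     {v \<in> V. x \<in> V \<and> \<bar>f x\<bar> \<noteq> \<infinity> \<and>
        0 \<le> Liminf (at x within V)
              (\<lambda>y. (f y - f x - ereal (v \<bullet> (y - x))) / ereal (norm (y - x)))}"

definition limiting_subdiff_on ::
    "'a::euclidean_space set \<Rightarrow> ('a \<Rightarrow> ereal) \<Rightarrow> 'a \<Rightarrow> 'a set" where
  "limiting_subdiff_on V f x =
     {v \<in> V. x \<in> V \<and> \<bar>f x\<bar> \<noteq> \<infinity> \<and>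
        (\<exists>X W. X \<longlonglongrightarrow> x \<and> (\<lambda>j. f (X j)) \<longlonglongrightarrow> f x \<and> W \<longlonglongrightarrow> v \<and>
               (\<forall>j. W j \<in> frechet_subdiff_on V f (X j)))}"

abbreviation limiting_subdiff ::
    "('a::euclidean_space \<Rightarrow> ereal) \<Rightarrow> 'a \<Rightarrow> 'a set" where
  "limiting_subdiff \<equiv> limiting_subdiff_on UNIV"

definition proper_lsc :: "('a::euclidean_space \<Rightarrow> ereal) \<Rightarrow> bool" where
  "proper_lsc f \<longleftrightarrow>
     (\<forall>x. f x \<noteq> -\<infinity>) \<and> (\<exists>x. f x \<noteq> \<infinity>) \<and> (\<forall>x. f x \<le> Liminf (at x) f)"

text \<open>
  The distance from \<open>0\<close> to \<open>\<partial>f(v)\<close> is an infimum in the extended reals, so that it is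
  \<open>+\<infinity>\<close> when \<open>\<partial>f(v)\<close> is empty (the real-valued \<open>infdist\<close> would return \<open>0\<close>).
\<close>

definition KL_property_at :: "('a::euclidean_space \<Rightarrow> ereal) \<Rightarrow> 'a \<Rightarrow> bool" where
  "KL_property_at f vbar \<longleftrightarrow>
     (\<exists>(\<sigma>::ereal) U (\<phi>::real \<Rightarrow> real).
        0 < \<sigma> \<and> open U \<and> vbar \<in> U \<and>
        (\<forall>s. 0 \<le> s \<and> ereal s < \<sigma> \<longrightarrow> 0 \<le> \<phi> s) \<and>
        continuous_on {s. 0 \<le> s \<and> ereal s < \<sigma>} \<phi> \<and>
        concave_on {s. 0 \<le> s \<and> ereal s < \<sigma>} \<phi> \<and>
        \<phi> 0 = 0 \<and>
        (\<forall>s. 0 < s \<and> ereal s < \<sigma> \<longrightarrow> \<phi> differentiable (at s)) \<and>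
        continuous_on {s. 0 < s \<and> ereal s < \<sigma>} (deriv \<phi>) \<and>
        (\<forall>s. 0 < s \<and> ereal s < \<sigma> \<longrightarrow> 0 < deriv \<phi> s) \<and>
        (\<forall>v\<in>U. f vbar < f v \<and> f v < f vbar + \<sigma> \<longrightarrow>
           1 \<le> ereal (deriv \<phi> (real_of_ereal (f v - f vbar)))
               * (INF \<xi>\<in>limiting_subdiff f v. ereal (norm \<xi>))))"

definition KL_function :: "('a::euclidean_space \<Rightarrow> ereal) \<Rightarrow> bool" where
  "KL_function f \<longleftrightarrow>
     proper_lsc f \<and> (\<forall>v. limiting_subdiff f v \<noteq> {} \<longrightarrow> KL_property_at f v)"


section \<open>Groups of variables\<close>

definition consecutive_partition :: "'n::{finite,linorder} set set \<Rightarrow> bool" where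
  "consecutive_partition G \<longleftrightarrow>
     partition_on UNIV G \<and> (\<forall>g\<in>G. \<forall>i\<in>g. \<forall>k\<in>g. {i..k} \<subseteq> g)"

text \<open>
  For an index set \<open>I\<close>, the space \<open>\<real>\<^sup>I\<close> is identified with the subspace \<open>coord_space I\<close> of the
  vectors supported in \<open>I\<close>, and the subvector of \<open>x\<close> with indices in \<open>I\<close> with the zero-padded
  vector \<open>subvec I x\<close>. This preserves inner products and the norms \<open>\<parallel>\<cdot>\<parallel>\<^sub>p\<close>. The subvector
  belonging to a set \<open>T\<close> of groups is \<open>subvec (\<Union>T) x\<close>.
\<close>

definition coord_space :: "'n::finite set \<Rightarrow> (real^'n) set" where
  "coord_space I = {w. \<forall>i. i \<notin> I \<longrightarrow> w $ i = 0}"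

definition subvec :: "'n::finite set \<Rightarrow> real^'n \<Rightarrow> real^'n" where
  "subvec I x = (\<chi> i. if i \<in> I then x $ i else 0)"

definition lp_norm :: "real \<Rightarrow> real^'n::finite \<Rightarrow> real" where
  "lp_norm p x = (\<Sum>i\<in>UNIV. \<bar>x $ i\<bar> powr p) powr (1 / p)"

definition group_supp :: "'n::finite set set \<Rightarrow> real^'n \<Rightarrow> 'n set set" where
  "group_supp G x = {g \<in> G. subvec g x \<noteq> 0}"


section \<open>The objective function\<close>

text \<open>Only the values of \<open>\<psi>\<close> on \<open>[0,\<infinity>)\<close> are relevant.\<close>

definition admissible_penalty :: "(real \<Rightarrow> real) \<Rightarrow> bool" where
  "admissible_penalty \<psi> \<longleftrightarrow>
     (\<forall>t\<ge>0. 0 \<le> \<psi> t) \<and> concave_on {0..} \<psi> \<and> \<psi> 0 = 0 \<and>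
     filterlim \<psi> at_top at_top \<and>
     (\<forall>t>0. \<psi> differentiable (at t)) \<and>
     (\<forall>t>0. deriv \<psi> differentiable (at t)) \<and>
     continuous_on {0<..} (deriv (deriv \<psi>)) \<and>
     filterlim (deriv \<psi>) at_top (at_right 0) \<and>
     mono_on {0<..} (deriv (deriv \<psi>))"

definition energy ::
    "real^'n^'m \<Rightarrow> real^'m \<Rightarrow> real \<Rightarrow> real \<Rightarrow> (real \<Rightarrow> real) \<Rightarrow> 'n set set \<Rightarrow> real^'n \<Rightarrow> real" where
  "energy A b \<alpha> p \<psi> G x =
     1/2 * (norm (A *v x - b))\<^sup>2 + \<alpha> * (\<Sum>g\<in>G. \<psi> (lp_norm p (subvec g x)))"

definition spectral_norm :: "real^'n^'m \<Rightarrow> real" where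
  "spectral_norm M = onorm (\<lambda>x. M *v x)"


section \<open>The iteration\<close>

definition t_bar :: "real^'n^'m \<Rightarrow> real \<Rightarrow> real \<Rightarrow> real" where
  "t_bar A \<beta> \<epsilon> =
     (let L = spectral_norm (transpose A ** A) in
       (sqrt ((\<beta> + L)\<^sup>2 - 4 * \<beta> * \<epsilon> * L) - (\<beta> - L)) / (2 * L))"

definition group_threshold :: "'n set set \<Rightarrow> real \<Rightarrow> real \<Rightarrow> real^'n \<Rightarrow> real^'n::finite" where
  "group_threshold G p \<tau> x = subvec (\<Union>{g \<in> G. lp_norm p (subvec g x) \<ge> \<tau>}) x"

definition subproblem ::
    "real^'n^'m \<Rightarrow> real^'m \<Rightarrow> real \<Rightarrow> real \<Rightarrow> (real \<Rightarrow> real) \<Rightarrow> real \<Rightarrow>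
     real^'n \<Rightarrow> real^'n \<Rightarrow> 'n set \<Rightarrow> real^'n \<Rightarrow> real" where
  "subproblem A b \<alpha> p \<psi> \<beta> xt z g w =
     (w - subvec g z) \<bullet> subvec g (transpose A *v (A *v z - b))
     + \<beta> / 2 * (norm (w - subvec g z))\<^sup>2
     + \<alpha> * (\<psi> (lp_norm p (subvec g xt))
            + deriv \<psi> (lp_norm p (subvec g xt)) * (lp_norm p w - lp_norm p (subvec g xt)))"

text \<open>
  \<open>xt\<close>, \<open>xp\<close>, \<open>S\<close>, \<open>z\<close> are the thresholded iterate at steps \<open>k\<close> and \<open>k - 1\<close> (by convention
  \<open>x 0\<close> at step \<open>-1\<close>), the group support of \<open>xt\<close>, and the extrapolated point.
\<close>

definition FITS3_sequence ::
    "real^'n^'m \<Rightarrow> real^'m \<Rightarrow> real \<Rightarrow> real \<Rightarrow> (real \<Rightarrow> real) \<Rightarrow> 'n set set \<Rightarrow>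
     real \<Rightarrow> real \<Rightarrow> real \<Rightarrow> (nat \<Rightarrow> real) \<Rightarrow> (nat \<Rightarrow> real^'n) \<Rightarrow> bool" where
  "FITS3_sequence A b \<alpha> p \<psi> G \<beta> \<tau> \<epsilon> t x \<longleftrightarrow>
     (\<forall>k. let xt = group_threshold G p \<tau> (x k);
              xp = (if k = 0 then x 0 else group_threshold G p \<tau> (x (k - 1)));
              S = group_supp G xt;
              z = subvec (\<Union>S) (xt + t k *\<^sub>R (xt - xp))
          in (\<forall>g\<in>G - S. subvec g (x (Suc k)) = 0) \<and>
             (\<forall>g\<in>S. \<exists>l\<in>limiting_subdiff_on (coord_space g)
                              (\<lambda>w. ereal (subproblem A b \<alpha> p \<psi> \<beta> xt z g w))
                              (subvec g (x (Suc k))).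
                norm l \<le> \<beta> * \<epsilon> / 2 * norm (subvec g (x (Suc k)) - subvec g xt)))"

end

theory Submission
  imports Defs
begin

text \<open>
  Since inactive groups stay at zero, the set of active groups eventually stabilizes, and from then
  on every active group has norm at least \<open>\<tau>\<close>; thresholding no longer acts and \<open>\<psi>\<close> is only
  evaluated where it is smooth. The concavity of \<open>\<psi>\<close> and the optimality of the subproblems then give
  a sufficient decrease of \<open>H(x (k + 1), x k)\<close>, and they produce subgradients of \<open>H\<close> bounded by two
  successive step lengths: \<open>\<psi>'\<close> is Lipschitz on \<open>[\<tau>, \<infinity>)\<close>, and \<open>\<psi>'(0+) = \<infinity>\<close> makes every vector a
  subgradient in the inactive directions. The iterates are bounded because \<open>\<psi>\<close> is coercive, and the
  KL inequality at a cluster point yields a finite path length.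
\<close>

section \<open>Norms and penalties\<close>

text \<open>The obstacle is that the energy may be discontinuous: \<open>\<psi>\<close> is concave
  on \<open>{0..}\<close> but may jump at 0, and its slope there is infinite. Function values
  converge along the iterates only because the support is fixed and active groups stay away from
  zero. General sum rules bound the limiting subdifferential of a sum from above, whereas here
  elements of it must be produced. Hence subgradients are exhibited through Frechet inequalities
  (\<open>frechet_minorant\<close>), which simply add up. The only given subgradients are those of
  the subproblems, where convexity turns them into global inequalities. Origin of the constants:
  with \<open>L\<close> the spectral norm of \<open>transpose A ** A\<close> and \<open>s\<close>
  the extrapolation parameter, one step lowers the energy by at least
  \<open>\<beta> * (1 - \<epsilon>) / 2\<close> times the squared new step, up to a loss of
  \<open>(L * s\<^sup>2 + (\<beta> - L) * s) / 2\<close> times the squared old step. The two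
  coefficients balance exactly at \<open>s = t_bar A \<beta> \<epsilon>\<close>, so a supremum below
  \<open>t_bar\<close> leaves a margin that is uniform in \<open>k\<close>.\<close>

lemma powr_jensen:
  fixes p s u v :: real
  assumes "p \<ge> 1" "0 \<le> s" "s \<le> 1" "0 \<le> u" "0 \<le> v"
  shows "((1 - s) * u + s * v) powr p \<le> (1 - s) * u powr p + s * v powr p"
proof -
  \<comment> \<open>With one argument zero the claim reduces to this bound for the weight of the
    other one; with both positive it is convexity of the power.\<close>
  have small: "r powr p \<le> r" if "0 \<le> r" "r \<le> 1" for r :: real
    using powr_mono'[of 1 p r] that assms(1) by simp
  consider "u = 0" | "v = 0" | "u > 0" "v > 0" using assms by fastforce
  then show ?thesis
  proof cases
    case 1
    then show ?thesis
      using small[of s] assms by (simp add: powr_mult mult_right_mono)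
  next
    case 2
    then show ?thesis
      using small[of "1 - s"] assms by (simp add: powr_mult mult_right_mono)
  next
    case 3
    then show ?thesis
      using convex_onD[OF powr_convex[OF assms(1)], of s u v] assms by simp
  qed
qed

section \<open>The \<open>p\<close>-norm: Minkowski's inequality, comparison with the Euclidean
  norm, continuity\<close>

lemma lp_norm_nonneg: "0 \<le> lp_norm p x"
  by (simp add: lp_norm_def)

lemma lp_norm_powr:
  assumes "p \<ge> 1"
  shows "lp_norm p x powr p = (\<Sum>i\<in>UNIV. \<bar>x $ i\<bar> powr p)"
  using assms by (simp add: lp_norm_def powr_powr sum_nonneg)

lemma lp_norm_leI:
  assumes "p \<ge> 1" "0 \<le> c" "(\<Sum>i\<in>UNIV. \<bar>x $ i\<bar> powr p) \<le> c powr p"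
  shows "lp_norm p x \<le> c"
proof -
  have "lp_norm p x \<le> (c powr p) powr (1 / p)"
    unfolding lp_norm_def using assms by (intro powr_mono2) (auto intro: sum_nonneg)
  then show ?thesis using assms by (simp add: powr_powr)
qed

lemma component_le_lp_norm:
  assumes "p \<ge> 1"
  shows "\<bar>x $ i\<bar> \<le> lp_norm p x"
proof (rule ccontr)
  assume "\<not> \<bar>x $ i\<bar> \<le> lp_norm p x"
  then have "lp_norm p x powr p < \<bar>x $ i\<bar> powr p"
    using assms by (intro powr_less_mono2) (auto simp: lp_norm_nonneg)
  moreover have "\<bar>x $ i\<bar> powr p \<le> (\<Sum>i\<in>UNIV. \<bar>x $ i\<bar> powr p)"
    by (rule member_le_sum) auto
  ultimately show False using lp_norm_powr[OF assms, of x] by simp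
qed

lemma lp_norm_zero [simp]: "lp_norm p 0 = 0"
  by (simp add: lp_norm_def)

lemma lp_norm_eq_0_iff:
  assumes "p \<ge> 1"
  shows "lp_norm p x = 0 \<longleftrightarrow> x = 0"
proof
  assume "lp_norm p x = 0"
  then have "\<bar>x $ i\<bar> \<le> 0" for i using component_le_lp_norm[OF assms, of x i] by simp
  then show "x = 0" by (simp add: vec_eq_iff)
qed simp

lemma lp_norm_scaleR:
  assumes "p \<ge> 1"
  shows "lp_norm p (c *\<^sub>R x) = \<bar>c\<bar> * lp_norm p x"
proof -
  have "lp_norm p (c *\<^sub>R x) = (\<bar>c\<bar> powr p * (\<Sum>i\<in>UNIV. \<bar>x $ i\<bar> powr p)) powr (1 / p)"
    by (simp add: lp_norm_def abs_mult powr_mult sum_distrib_left)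
  also have "\<dots> = \<bar>c\<bar> * lp_norm p x"
    using assms by (subst powr_mult) (auto simp: sum_nonneg powr_powr lp_norm_def)
  finally show ?thesis .
qed

text \<open>Normalisation: \<open>(x + y) / (a + c)\<close> is the convex combination of the unit
  vectors \<open>x / a\<close> and \<open>y / c\<close> with weights \<open>1 - s\<close> and
  \<open>s = c / (a + c)\<close>, and \<open>powr_jensen\<close> applies in each coordinate.\<close>

lemma lp_norm_triangle:
  fixes x y :: "real^'n"
  assumes "p \<ge> 1"
  shows "lp_norm p (x + y) \<le> lp_norm p x + lp_norm p y"
proof -
  define a where "a = lp_norm p x"
  define c where "c = lp_norm p y"
  show ?thesis
  proof (cases "a = 0 \<or> c = 0")
    case True
    then show ?thesis
      using assms by (auto simp: a_def c_def lp_norm_eq_0_iff lp_norm_nonneg)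
  next
    case False
    then have pos: "a > 0" "c > 0"
      using lp_norm_nonneg[of p x] lp_norm_nonneg[of p y] by (auto simp: a_def c_def)
    define s where "s = c / (a + c)"
    have s: "0 \<le> s" "s \<le> 1" "1 - s = a / (a + c)" using pos by (auto simp: s_def field_simps)
    have "(\<Sum>i\<in>UNIV. \<bar>(x + y) $ i\<bar> powr p)
        \<le> (\<Sum>i\<in>UNIV. (a + c) powr p * ((1 - s) * (\<bar>x $ i\<bar> / a) powr p + s * (\<bar>y $ i\<bar> / c) powr p))"
    proof (rule sum_mono)
      fix i
      have "\<bar>(x + y) $ i\<bar> \<le> (a + c) * ((1 - s) * (\<bar>x $ i\<bar> / a) + s * (\<bar>y $ i\<bar> / c))"
      proof -
        have "(a + c) * (1 - s) = a" "(a + c) * s = c" using pos s by (auto simp: s_def)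
        then have "(a + c) * ((1 - s) * (\<bar>x $ i\<bar> / a) + s * (\<bar>y $ i\<bar> / c)) = \<bar>x $ i\<bar> + \<bar>y $ i\<bar>"
          using pos unfolding distrib_left by (simp flip: mult.assoc)
        then show ?thesis by simp
      qed
      then have "\<bar>(x + y) $ i\<bar> powr p
          \<le> ((a + c) * ((1 - s) * (\<bar>x $ i\<bar> / a) + s * (\<bar>y $ i\<bar> / c))) powr p"
        using assms by (intro powr_mono2) auto
      also have "\<dots> = (a + c) powr p * ((1 - s) * (\<bar>x $ i\<bar> / a) + s * (\<bar>y $ i\<bar> / c)) powr p"
        by (rule powr_mult)
      also have "\<dots> \<le> (a + c) powr p * ((1 - s) * (\<bar>x $ i\<bar> / a) powr p + s * (\<bar>y $ i\<bar> / c) powr p)"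
        using pos s assms by (intro mult_left_mono powr_jensen) auto
      finally show "\<bar>(x + y) $ i\<bar> powr p
          \<le> (a + c) powr p * ((1 - s) * (\<bar>x $ i\<bar> / a) powr p + s * (\<bar>y $ i\<bar> / c) powr p)" .
    qed
    also have "\<dots> = (a + c) powr p * ((1 - s) * ((\<Sum>i\<in>UNIV. \<bar>x $ i\<bar> powr p) / a powr p)
        + s * ((\<Sum>i\<in>UNIV. \<bar>y $ i\<bar> powr p) / c powr p))"
      using pos by (simp add: powr_divide sum.distrib flip: sum_distrib_left sum_divide_distrib)
    also have "\<dots> = (a + c) powr p"
      using pos by (simp flip: lp_norm_powr[OF assms] a_def c_def)
    finally have "lp_norm p (x + y) \<le> a + c"
      using pos assms by (intro lp_norm_leI) auto
    then show ?thesis by (simp add: a_def c_def)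
  qed
qed

text \<open>The constant comes from bounding every coordinate by the Euclidean norm. It reappears as
  the Lipschitz constant of the \<open>p\<close>-norm and as \<open>q\<close> in
  \<open>energy_subgradient\<close>.\<close>

lemma lp_norm_le_norm:
  fixes x :: "real^'n"
  assumes "p \<ge> 1"
  shows "lp_norm p x \<le> real CARD('n) powr (1 / p) * norm x"
proof (rule lp_norm_leI[OF assms])
  have "(\<Sum>i\<in>UNIV. \<bar>x $ i\<bar> powr p) \<le> (\<Sum>i\<in>(UNIV :: 'n set). norm x powr p)"
    using assms by (intro sum_mono powr_mono2) (auto simp: component_le_norm_cart)
  also have "\<dots> = (real CARD('n) powr (1 / p) * norm x) powr p"
    using assms by (simp add: powr_mult powr_powr)
  finally show "(\<Sum>i\<in>UNIV. \<bar>x $ i\<bar> powr p) \<le> (real CARD('n) powr (1 / p) * norm x) powr p" .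
qed simp

lemma lp_norm_diff_le:
  fixes x y :: "real^'n"
  assumes "p \<ge> 1"
  shows "\<bar>lp_norm p x - lp_norm p y\<bar> \<le> real CARD('n) powr (1 / p) * norm (x - y)"
proof -
  have "lp_norm p x - lp_norm p y \<le> lp_norm p (x - y)"
    using lp_norm_triangle[OF assms, of "x - y" y] by simp
  moreover have "lp_norm p y - lp_norm p x \<le> lp_norm p (y - x)"
    using lp_norm_triangle[OF assms, of "y - x" x] by simp
  moreover have "lp_norm p (y - x) = lp_norm p (x - y)"
    using lp_norm_scaleR[OF assms, of "-1" "x - y"] by simp
  ultimately show ?thesis using lp_norm_le_norm[OF assms, of "x - y"] by linarith
qed

lemma convex_on_lp_norm:
  assumes "p \<ge> 1"
  shows "convex_on UNIV (lp_norm p)"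
proof (rule convex_onI)
  fix t :: real and x y :: "real^'n" assume t: "0 < t" "t < 1"
  show "lp_norm p ((1 - t) *\<^sub>R x + t *\<^sub>R y) \<le> (1 - t) * lp_norm p x + t * lp_norm p y"
    using lp_norm_triangle[OF assms, of "(1 - t) *\<^sub>R x" "t *\<^sub>R y"] t
    by (simp add: lp_norm_scaleR[OF assms])
qed simp

lemma tendsto_lp_norm:
  fixes f :: "'b \<Rightarrow> real^'n"
  assumes "p \<ge> 1" "(f \<longlongrightarrow> l) F"
  shows "((\<lambda>j. lp_norm p (f j)) \<longlongrightarrow> lp_norm p l) F"
proof -
  have "((\<lambda>j. real CARD('n) powr (1 / p) * norm (f j - l)) \<longlongrightarrow> 0) F"
    using assms(2) by (intro tendsto_mult_right_zero tendsto_norm_zero) (simp add: LIM_zero_iff)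
  then have "((\<lambda>j. lp_norm p (f j) - lp_norm p l) \<longlongrightarrow> 0) F"
    by (rule Lim_null_comparison[rotated])
      (use lp_norm_diff_le[OF assms(1), of "f _" l] in \<open>simp add: always_eventually\<close>)
  then show ?thesis by (simp add: LIM_zero_iff)
qed

text \<open>The point of tangency is interior but \<open>s\<close> may be an endpoint, so that for
  \<open>\<psi>\<close> the inequality can be evaluated at \<open>s = 0\<close>, where the slope is
  infinite.\<close>

lemma concave_on_tangent:
  fixes f :: "real \<Rightarrow> real"
  assumes "concave_on A f" "connected A" "f differentiable (at a)" "a \<in> interior A" "s \<in> A"
  shows "f s \<le> f a + deriv f a * (s - a)"
proof -
  have "((\<lambda>r. - f r) has_field_derivative - deriv f a) (at a within A)"
    using assms(3) by (intro DERIV_minus) (auto simp: DERIV_deriv_iff_real_differentiable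
      intro: has_field_derivative_at_within)
  from convex_on_imp_above_tangent[OF _ assms(2,4,5) this] assms(1)
  show ?thesis by (simp add: concave_on_def algebra_simps)
qed

section \<open>Slopes of the penalty\<close>

context
  fixes \<psi> :: "real \<Rightarrow> real"
  assumes adm: "admissible_penalty \<psi>"
begin

lemma penalty_nonneg: "0 \<le> \<psi> (lp_norm p x)"
  using adm lp_norm_nonneg[of p x] by (simp add: admissible_penalty_def)

lemma penalty_tangent:
  assumes "0 < a" "0 \<le> s"
  shows "\<psi> s \<le> \<psi> a + deriv \<psi> a * (s - a)"
  using concave_on_tangent[of "{0..}" \<psi> a s] adm assms by (auto simp: admissible_penalty_def)

text \<open>Adding the tangent inequalities at \<open>a\<close> and at \<open>b\<close> cancels the
  function values.\<close>

lemma penalty_deriv_antimono: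
  assumes "0 < a" "a \<le> b"
  shows "deriv \<psi> b \<le> deriv \<psi> a"
proof (cases "a = b")
  case False
  have "0 \<le> (deriv \<psi> a - deriv \<psi> b) * (b - a)"
    using penalty_tangent[of a b] penalty_tangent[of b a] assms by (simp add: algebra_simps)
  then show ?thesis using False assms by (simp add: zero_le_mult_iff)
qed simp

text \<open>A nonpositive slope would, by the tangent inequality, keep \<open>\<psi>\<close> below
  \<open>\<psi> a\<close> to the right of \<open>a\<close>, against coercivity.\<close>

lemma penalty_deriv_pos:
  assumes "0 < a"
  shows "0 < deriv \<psi> a"
proof (rule ccontr)
  assume neg: "\<not> 0 < deriv \<psi> a"
  have "filterlim \<psi> at_top at_top" using adm by (simp add: admissible_penalty_def)
  then have "eventually (\<lambda>s. \<psi> a + 1 \<le> \<psi> s) at_top" by (simp add: filterlim_at_top)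
  then obtain N where N: "\<And>s. s \<ge> N \<Longrightarrow> \<psi> a + 1 \<le> \<psi> s" by (auto simp: eventually_at_top_linorder)
  have "\<psi> (max N a) \<le> \<psi> a"
    using penalty_tangent[of a "max N a"] neg assms
      mult_nonpos_nonneg[of "deriv \<psi> a" "max N a - a"] by linarith
  then show False using N[of "max N a"] by simp
qed

lemma penalty_ge_deriv_mult:
  assumes "0 < s"
  shows "deriv \<psi> s * s \<le> \<psi> s"
  using penalty_tangent[of s 0] adm assms by (simp add: admissible_penalty_def)

text \<open>Since \<open>deriv \<psi>\<close> decreases, only a lower bound of the second derivative
  matters, and by monotonicity its value at \<open>\<tau>\<close> is one.\<close>

lemma penalty_deriv_lipschitz:
  assumes "0 < \<tau>"
  obtains K where "0 \<le> K"
    "\<And>a b. \<tau> \<le> a \<Longrightarrow> \<tau> \<le> b \<Longrightarrow> \<bar>deriv \<psi> a - deriv \<psi> b\<bar> \<le> K * \<bar>a - b\<bar>"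
proof -
  define K where "K = \<bar>deriv (deriv \<psi>) \<tau>\<bar>"
  have main: "\<bar>deriv \<psi> a - deriv \<psi> b\<bar> \<le> K * \<bar>a - b\<bar>" if ab: "\<tau> \<le> a" "a < b" for a b
  proof -
    have "\<And>s. a \<le> s \<Longrightarrow> s \<le> b \<Longrightarrow> (deriv \<psi> has_real_derivative deriv (deriv \<psi>) s) (at s)"
      using adm ab assms by (auto simp: admissible_penalty_def DERIV_deriv_iff_real_differentiable)
    from MVT2[OF ab(2) this]
    obtain z where z: "a < z" "deriv \<psi> b - deriv \<psi> a = (b - a) * deriv (deriv \<psi>) z" by auto
    have "mono_on {0<..} (deriv (deriv \<psi>))" using adm by (simp add: admissible_penalty_def)
    then have "deriv (deriv \<psi>) \<tau> \<le> deriv (deriv \<psi>) z"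
      by (rule mono_onD) (use ab z assms in auto)
    then have "(b - a) * - K \<le> (b - a) * deriv (deriv \<psi>) z"
      using ab by (intro mult_left_mono) (auto simp: K_def)
    then show ?thesis
      using z ab penalty_deriv_antimono[of a b] assms by (simp add: algebra_simps)
  qed
  show ?thesis
  proof (rule that[of K])
    show "0 \<le> K" by (simp add: K_def)
    fix a b assume "\<tau> \<le> a" "\<tau> \<le> b"
    then show "\<bar>deriv \<psi> a - deriv \<psi> b\<bar> \<le> K * \<bar>a - b\<bar>"
      using main[of a b] main[of b a] by (cases a b rule: linorder_cases)
        (auto simp: abs_minus_commute)
  qed
qed

text \<open>The tangent at \<open>s\<close> evaluated at 0 gives
  \<open>deriv \<psi> s * s \<le> \<psi> s\<close>, and near 0 the slope exceeds every
  \<open>r\<close>.\<close>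

lemma penalty_eventually_ge_mult:
  assumes "0 < r"
  obtains \<delta> where "0 < \<delta>" "\<And>s. 0 \<le> s \<Longrightarrow> s < \<delta> \<Longrightarrow> r * s \<le> \<psi> s"
proof -
  have "filterlim (deriv \<psi>) at_top (at_right 0)" using adm by (simp add: admissible_penalty_def)
  then have "eventually (\<lambda>s. r \<le> deriv \<psi> s) (at_right 0)" by (simp add: filterlim_at_top)
  then obtain \<delta> where \<delta>: "0 < \<delta>" "\<And>s. 0 < s \<Longrightarrow> s < \<delta> \<Longrightarrow> r \<le> deriv \<psi> s"
    unfolding eventually_at_right_field by auto
  show ?thesis
  proof (rule that[OF \<delta>(1)])
    fix s :: real assume s: "0 \<le> s" "s < \<delta>"
    show "r * s \<le> \<psi> s"
    proof (cases "s = 0")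
      case True
      then show ?thesis using adm by (simp add: admissible_penalty_def)
    next
      case False
      then have "0 < s" using s by simp
      from penalty_ge_deriv_mult[OF this] mult_right_mono[OF \<delta>(2)[OF this s(2)], of s] s
      show ?thesis by linarith
    qed
  qed
qed

end

section \<open>Sequences of finite length\<close>

text \<open>The induction carries an additional \<open>a l\<close> on the left, which absorbs the
  half of the preceding term when the recursion is used twice.\<close>

lemma sum_le_of_halving:
  fixes a D :: "nat \<Rightarrow> real"
  assumes "n \<le> m" "0 \<le> a m" "0 \<le> D m"
    and "\<And>k. n \<le> k \<Longrightarrow> k < m \<Longrightarrow> a (Suc k) \<le> a k / 2 + (D k - D (Suc k))"
  shows "(\<Sum>k=n..m. a k) \<le> 2 * a n + 2 * D n"
proof -
  have "l \<le> m \<Longrightarrow> (\<Sum>k=n..l. a k) + a l \<le> 2 * a n + 2 * (D n - D l)" if "n \<le> l" for l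
    using that
  proof (induction l rule: dec_induct)
    case (step l)
    then show ?case using assms(4)[of l] by (simp add: field_simps)
  qed simp
  from this[OF assms(1)] show ?thesis using assms(2,3) by simp
qed

lemma norm_diff_le_sum:
  fixes y :: "nat \<Rightarrow> 'a::real_normed_vector"
  assumes "n \<le> m"
  shows "norm (y (Suc m) - y n) \<le> (\<Sum>k=n..m. norm (y (Suc k) - y k))"
  using assms
proof (induction m rule: dec_induct)
  case (step m)
  have "norm (y (Suc (Suc m)) - y n) \<le> norm (y (Suc (Suc m)) - y (Suc m)) + norm (y (Suc m) - y n)"
    by (rule order_trans[OF _ norm_triangle_ineq]) simp
  then show ?case using step by simp
qed simp

text \<open>
  The KL inequality turns the descent of \<open>h\<close> into a recursive bound for the step lengths, in which
  \<open>\<phi> \<circ> h\<close> telescopes. The resulting bound for the path length keeps the sequence in the ball on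
  which the inequality is available.
\<close>

lemma KL_descent_summable:
  fixes y :: "nat \<Rightarrow> 'a::real_normed_vector" and h :: "nat \<Rightarrow> real" and \<phi> \<phi>' :: "real \<Rightarrow> real"
  assumes pos: "0 < c" "0 < C" "0 < \<rho>" "0 < \<sigma>"
    and h_nonneg: "\<And>k. 0 \<le> h k"
    and descent: "\<And>k. h (Suc k) + c * (norm (y (Suc k) - y k))\<^sup>2 \<le> h k"
    and h_lim: "h \<longlonglongrightarrow> 0"
    and cluster: "strict_mono r" "(y \<circ> r) \<longlonglongrightarrow> ybar"
    and phi_lim: "(\<lambda>k. \<phi> (h k)) \<longlonglongrightarrow> 0"
    and phi_nonneg: "\<And>s. 0 \<le> s \<Longrightarrow> s < \<sigma> \<Longrightarrow> 0 \<le> \<phi> s"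
    and phi_pos: "\<And>s. 0 < s \<Longrightarrow> s < \<sigma> \<Longrightarrow> 0 < \<phi>' s"
    and phi_tangent: "\<And>s s'. 0 < s \<Longrightarrow> s < \<sigma> \<Longrightarrow> 0 \<le> s' \<Longrightarrow> s' < \<sigma> \<Longrightarrow> \<phi>' s * (s - s') \<le> \<phi> s - \<phi> s'"
    and KL: "\<And>k. 0 < h (Suc k) \<Longrightarrow> h (Suc k) < \<sigma> \<Longrightarrow>
      y (Suc k) \<in> ball ybar \<rho> \<Longrightarrow> y (Suc (Suc k)) \<in> ball ybar \<rho> \<Longrightarrow>
      1 \<le> \<phi>' (h (Suc k)) * (C * (norm (y (Suc (Suc k)) - y (Suc k)) + norm (y (Suc k) - y k)))"
  shows "summable (\<lambda>k. norm (y (Suc k) - y k))"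
proof -
  define a where "a k = norm (y (Suc k) - y k)" for k
  define M where "M = C / c"
  \<comment> \<open>The shift makes \<open>D k - D (Suc k)\<close> the drop of \<open>\<phi>\<close>
    across the step of length \<open>a (Suc k)\<close>; the factor 2 is left over from the rounding
    at the end of \<open>rec\<close>.\<close>
  define D where "D k = 2 * M * \<phi> (h (Suc k))" for k
  have a_nonneg: "0 \<le> a k" for k by (simp add: a_def)
  have M: "0 < M" using pos by (simp add: M_def)
  have desc: "c * (a k)\<^sup>2 \<le> h k - h (Suc k)" for k using descent[of k] by (simp add: a_def)
  have rec: "a (Suc k) \<le> a k / 2 + (D k - D (Suc k))"
    if k: "h (Suc k) < \<sigma>" "y (Suc k) \<in> ball ybar \<rho>" "y (Suc (Suc k)) \<in> ball ybar \<rho>" for k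
  proof (cases "h (Suc k) = 0")
    \<comment> \<open>The KL inequality is silent when the gap is zero, but then the descent forces
      the next step to vanish.\<close>
    case True
    moreover have "0 \<le> c * (a (Suc k))\<^sup>2" using pos(1) by simp
    ultimately have "c * (a (Suc k))\<^sup>2 \<le> 0" "h (Suc (Suc k)) = 0"
      using desc[of "Suc k"] h_nonneg[of "Suc (Suc k)"] by linarith+
    then have "a (Suc k) = 0" using pos(1) by (simp add: mult_le_0_iff)
    then show ?thesis using True \<open>h (Suc (Suc k)) = 0\<close> a_nonneg[of k] by (simp add: D_def)
  next
    case False
    then have hpos: "0 < h (Suc k)" using h_nonneg[of "Suc k"] by simp
    define w where "w = a (Suc k) + a k"
    define d where "d = \<phi> (h (Suc k)) - \<phi> (h (Suc (Suc k)))"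
    have w: "0 \<le> w" by (simp add: w_def a_nonneg)
    have le: "h (Suc (Suc k)) \<le> h (Suc k)"
    proof -
      have "0 \<le> c * (a (Suc k))\<^sup>2" using pos(1) by simp
      then show ?thesis using desc[of "Suc k"] by linarith
    qed
    have "\<phi>' (h (Suc k)) * (c * (a (Suc k))\<^sup>2) \<le> \<phi>' (h (Suc k)) * (h (Suc k) - h (Suc (Suc k)))"
      using desc[of "Suc k"] phi_pos[OF hpos k(1)] by (intro mult_left_mono) auto
    also have "\<dots> \<le> d"
      unfolding d_def using hpos k(1) le h_nonneg[of "Suc (Suc k)"] by (intro phi_tangent) auto
    finally have 1: "\<phi>' (h (Suc k)) * (c * (a (Suc k))\<^sup>2) \<le> d" .
    \<comment> \<open>Multiplying by \<open>c\<close> times the squared step eliminates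
      \<open>\<phi>'\<close>, because \<open>\<phi>'\<close> times that quantity is at most
      \<open>d\<close>.\<close>
    have "1 \<le> \<phi>' (h (Suc k)) * (C * w)" using KL[OF hpos k] by (simp add: a_def w_def)
    then have "c * (a (Suc k))\<^sup>2 * 1 \<le> c * (a (Suc k))\<^sup>2 * (\<phi>' (h (Suc k)) * (C * w))"
      using pos(1) by (intro mult_left_mono) auto
    also have "\<dots> = \<phi>' (h (Suc k)) * (c * (a (Suc k))\<^sup>2) * (C * w)" by simp
    also have "\<dots> \<le> d * (C * w)" using 1 w pos by (intro mult_right_mono) auto
    finally have sq: "(a (Suc k))\<^sup>2 \<le> M * d * w"
      using pos by (simp add: M_def field_simps)
    \<comment> \<open>AM-GM applied to \<open>w / 2\<close> and \<open>2 * M * d\<close>\<close>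
    have "M * d * w \<le> (w / 4 + M * d)\<^sup>2"
      using zero_le_power2[of "w / 4 - M * d"] by (simp add: power2_eq_square algebra_simps)
    then have sq': "(a (Suc k))\<^sup>2 \<le> (w / 4 + M * d)\<^sup>2" using sq by linarith
    have "0 \<le> d"
      using 1 phi_pos[OF hpos k(1)] pos(1)
      by (meson less_imp_le mult_nonneg_nonneg order_trans zero_le_power2)
    then have Md: "0 \<le> M * d" using M by simp
    have "a (Suc k) \<le> w / 4 + M * d"
      by (rule power2_le_imp_le[OF sq']) (use w Md in simp)
    \<comment> \<open>Moving the \<open>a (Suc k)\<close> contained in \<open>w\<close> to the left
      gives the factors 1/3 and 4/3, which are rounded up to 1/2 and 2.\<close>
    then have "a (Suc k) \<le> a k / 2 + 2 * (M * d)"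
      using Md a_nonneg[of k] unfolding w_def by (simp add: field_simps)
    then show ?thesis by (simp add: D_def d_def algebra_simps)
  qed
  have a_lim: "a \<longlonglongrightarrow> 0"
  proof -
    have "(\<lambda>k. (a k)\<^sup>2) \<longlonglongrightarrow> 0"
    proof (rule tendsto_sandwich[of "\<lambda>_. 0" _ _ "\<lambda>k. h k / c"])
      show "\<forall>\<^sub>F k in sequentially. (a k)\<^sup>2 \<le> h k / c"
      proof (rule always_eventually, rule allI)
        fix k
        show "(a k)\<^sup>2 \<le> h k / c"
          using desc[of k] h_nonneg[of "Suc k"] pos(1) by (simp add: field_simps)
      qed
      show "(\<lambda>k. h k / c) \<longlonglongrightarrow> 0" using h_lim pos(1) by (auto intro!: tendsto_eq_intros)
    qed auto
    then have "(\<lambda>k. sqrt ((a k)\<^sup>2)) \<longlonglongrightarrow> sqrt 0" by (rule tendsto_real_sqrt)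
    then show ?thesis by (simp add: a_nonneg)
  qed
  have D_lim: "D \<longlonglongrightarrow> 0"
    unfolding D_def using LIMSEQ_Suc[OF phi_lim] by (auto intro!: tendsto_eq_intros)
  \<comment> \<open>Budget for the radius: the start lies within \<open>\<rho> / 4\<close> of
    \<open>ybar\<close>, the path is shorter than \<open>2 * a n + 2 * D n < \<rho> / 2\<close>, and
    one further step adds less than \<open>\<rho> / 8\<close>.\<close>
  have "eventually (\<lambda>k. h k < \<sigma> \<and> a k < \<rho> / 8 \<and> D k < \<rho> / 8) sequentially"
    using pos(3) by (intro eventually_conj order_tendstoD(2)[OF h_lim pos(4)]
      order_tendstoD(2)[OF a_lim] order_tendstoD(2)[OF D_lim]) auto
  then obtain N where N: "\<And>k. N \<le> k \<Longrightarrow> h k < \<sigma> \<and> a k < \<rho> / 8 \<and> D k < \<rho> / 8"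
    by (auto simp: eventually_sequentially)
  have "eventually (\<lambda>j. dist ((y \<circ> r) j) ybar < \<rho> / 4) sequentially"
    by (rule tendstoD[OF cluster(2)]) (use pos(3) in simp)
  then obtain J where J: "\<And>j. J \<le> j \<Longrightarrow> dist (y (r j)) ybar < \<rho> / 4"
    by (auto simp: eventually_sequentially)
  \<comment> \<open>This index is late enough for the smallness conditions and at the same time lies
    on the convergent subsequence.\<close>
  define n where "n = r (max N J)"
  have nN: "N \<le> n" unfolding n_def by (rule order_trans[OF _ seq_suble[OF cluster(1)]]) simp
  have n: "dist (y n) ybar < \<rho> / 4" unfolding n_def by (rule J) simp
  have D_nonneg: "0 \<le> D k" if "n \<le> k" for k
    unfolding D_def using M N[of "Suc k"] that nN
    by (intro mult_nonneg_nonneg phi_nonneg) (auto simp: h_nonneg)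
  have near: "y k \<in> ball ybar \<rho>" if "dist (y k) (y n) < 3 * \<rho> / 4" for k
    using dist_triangle[of "y k" ybar "y n"] n that by (simp add: dist_commute)
  have path: "(\<Sum>k=n..m. a k) < \<rho> / 2"
    if "n \<le> m" "\<And>k. n \<le> k \<Longrightarrow> k \<le> Suc m \<Longrightarrow> y k \<in> ball ybar \<rho>" for m
  proof -
    have "(\<Sum>k=n..m. a k) \<le> 2 * a n + 2 * D n"
      using that nN N by (intro sum_le_of_halving rec) (auto simp: a_nonneg D_nonneg)
    then show ?thesis using N[OF nN] by linarith
  qed
  \<comment> \<open>The sum up to \<open>m\<close> uses the recursion at points up to
    \<open>Suc m\<close>. The next point is then reached from the path bound and the smallness of a
    single step, so the argument is not circular.\<close>
  have inball: "\<forall>k. n \<le> k \<and> k \<le> Suc m \<longrightarrow> y k \<in> ball ybar \<rho>" if "n \<le> m" for m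
    using that
  proof (induction m rule: dec_induct)
    case base
    have "y n \<in> ball ybar \<rho>" "y (Suc n) \<in> ball ybar \<rho>"
      using N[OF nN] pos(3) by (intro near; simp add: a_def dist_norm)+
    then show ?case by (auto simp: le_Suc_eq)
  next
    case (step m)
    have "norm (y (Suc m) - y n) < \<rho> / 2"
      using path[OF step(1)] step(3) norm_diff_le_sum[OF step(1), of y] by (auto simp: a_def)
    moreover have "norm (y (Suc (Suc m)) - y (Suc m)) < \<rho> / 8"
      using N[of "Suc m"] step(1) nN by (auto simp: a_def)
    moreover have "norm (y (Suc (Suc m)) - y n)
        \<le> norm (y (Suc (Suc m)) - y (Suc m)) + norm (y (Suc m) - y n)"
      by (rule order_trans[OF _ norm_triangle_ineq]) simp
    ultimately have "y (Suc (Suc m)) \<in> ball ybar \<rho>"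
      using pos(3) by (intro near) (simp add: dist_norm)
    then show ?case using step(3) by (auto simp: le_Suc_eq)
  qed
  have "summable (\<lambda>k. a (k + n))"
  proof (rule summableI_nonneg_bounded)
    fix m
    have "(\<Sum>k<m. a (k + n)) = (\<Sum>k=n..<n + m. a k)"
      using sum.shift_bounds_nat_ivl[of a 0 n m] by (simp add: lessThan_atLeast0 add.commute)
    also have "\<dots> \<le> (\<Sum>k=n..n + m. a k)" by (intro sum_mono2) (auto simp: a_nonneg)
    also have "\<dots> \<le> \<rho> / 2" using path[of "n + m"] inball[of "n + m"] by auto
    finally show "(\<Sum>k<m. a (k + n)) \<le> \<rho> / 2" .
  qed (simp add: a_nonneg)
  then show ?thesis using summable_iff_shift[of a n] by (simp add: a_def[abs_def])
qed

section \<open>Subgradients\<close>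

text \<open>The Frechet subgradient condition for a finite function, cleared of the quotient. At
  \<open>y = x\<close> it is trivial, so full neighbourhoods can be used and limits compose
  easily.\<close>

definition frechet_minorant :: "('a::real_inner \<Rightarrow> real) \<Rightarrow> 'a \<Rightarrow> 'a \<Rightarrow> bool" where
  "frechet_minorant f x v \<longleftrightarrow>
     (\<forall>\<eta>>0. \<forall>\<^sub>F y in nhds x. v \<bullet> (y - x) - \<eta> * norm (y - x) \<le> f y - f x)"

lemma frechet_subdiff_on_iff:
  "v \<in> frechet_subdiff_on V (\<lambda>y. ereal (f y)) x \<longleftrightarrow>
     v \<in> V \<and> x \<in> V \<and>
     (\<forall>\<eta>>0. \<forall>\<^sub>F y in at x within V. v \<bullet> (y - x) - \<eta> * norm (y - x) \<le> f y - f x)"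
proof -
  define q where "q y = (f y - f x - v \<bullet> (y - x)) / norm (y - x)" for y
  have q: "\<forall>\<^sub>F y in at x within V. y \<noteq> x \<and>
      (ereal (f y) - ereal (f x) - ereal (v \<bullet> (y - x))) / ereal (norm (y - x)) = ereal (q y)"
    by (auto simp: eventually_at_filter q_def)
  have "0 \<le> Liminf (at x within V)
        (\<lambda>y. (ereal (f y) - ereal (f x) - ereal (v \<bullet> (y - x))) / ereal (norm (y - x)))
      \<longleftrightarrow> (\<forall>\<eta>>0. \<forall>\<^sub>F y in at x within V. v \<bullet> (y - x) - \<eta> * norm (y - x) \<le> f y - f x)"
    (is "?L \<longleftrightarrow> ?R")
  proof
    assume L: ?L
    show ?R
    proof (intro allI impI)
      fix \<eta> :: real assume "\<eta> > 0"
      then have "ereal (- \<eta>) < 0" by simp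
      then have "\<forall>\<^sub>F y in at x within V. ereal (- \<eta>) <
          (ereal (f y) - ereal (f x) - ereal (v \<bullet> (y - x))) / ereal (norm (y - x))"
        using L unfolding le_Liminf_iff by blast
      with q show "\<forall>\<^sub>F y in at x within V. v \<bullet> (y - x) - \<eta> * norm (y - x) \<le> f y - f x"
      proof eventually_elim
        case (elim y)
        then have "ereal (- \<eta>) < ereal (q y)" by metis
        then have "- \<eta> < q y" by simp
        then have "- \<eta> * norm (y - x) \<le> q y * norm (y - x)" by (intro mult_right_mono) auto
        then show ?case using elim by (simp add: q_def)
      qed
    qed
  next
    assume R: ?R
    show ?L
      unfolding le_Liminf_iff
    proof (intro allI impI)
      fix c :: ereal assume "c < 0"
      then obtain r where r: "c < ereal r" "ereal r < 0" using ereal_dense2 by blast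
      then have "\<forall>\<^sub>F y in at x within V. v \<bullet> (y - x) - (- r) * norm (y - x) \<le> f y - f x"
        using R[rule_format, of "- r"] by simp
      with q show "\<forall>\<^sub>F y in at x within V. c <
          (ereal (f y) - ereal (f x) - ereal (v \<bullet> (y - x))) / ereal (norm (y - x))"
      proof eventually_elim
        case (elim y)
        then have "r \<le> q y" by (simp add: q_def field_simps)
        then have "ereal r \<le> ereal (q y)" by simp
        with r(1) have "c < ereal (q y)" by (rule less_le_trans)
        then show ?case using elim by metis
      qed
    qed
  qed
  then show ?thesis by (simp add: frechet_subdiff_on_def)
qed

lemma frechet_minorant_imp_subdiff:
  assumes "frechet_minorant f x v"
  shows "v \<in> frechet_subdiff_on UNIV (\<lambda>y. ereal (f y)) x"
  unfolding frechet_subdiff_on_iff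
  using assms by (auto simp: frechet_minorant_def eventually_at_filter elim: eventually_mono)

lemma limiting_subdiff_seqI:
  assumes "X \<longlonglongrightarrow> x" "(\<lambda>j. f (X j)) \<longlonglongrightarrow> f x" "W \<longlonglongrightarrow> v" "\<And>j. frechet_minorant f (X j) (W j)"
  shows "v \<in> limiting_subdiff (\<lambda>y. ereal (f y)) x"
  unfolding limiting_subdiff_on_def using assms frechet_minorant_imp_subdiff by fastforce

lemma frechet_minorant_imp_limiting:
  assumes "frechet_minorant f x v"
  shows "v \<in> limiting_subdiff (\<lambda>y. ereal (f y)) x"
  by (rule limiting_subdiff_seqI[of "\<lambda>_. x" _ _ "\<lambda>_. v"]) (use assms in auto)

lemma frechet_minorant_global:
  assumes "\<And>y. v \<bullet> (y - x) \<le> f y - f x"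
  shows "frechet_minorant f x v"
  unfolding frechet_minorant_def
proof (intro allI impI always_eventually)
  fix \<eta> :: real and y assume "\<eta> > 0"
  then have "0 \<le> \<eta> * norm (y - x)" by simp
  then show "v \<bullet> (y - x) - \<eta> * norm (y - x) \<le> f y - f x" using assms[of y] by linarith
qed

text \<open>The half of the sum rule that holds without regularity conditions; each summand receives
  half of the error \<open>\<eta>\<close>.\<close>

lemma frechet_minorant_add:
  assumes "frechet_minorant f x v" "frechet_minorant g x w"
  shows "frechet_minorant (\<lambda>y. f y + g y) x (v + w)"
  unfolding frechet_minorant_def
proof (intro allI impI)
  fix \<eta> :: real assume "\<eta> > 0"
  then have "\<forall>\<^sub>F y in nhds x. v \<bullet> (y - x) - \<eta> / 2 * norm (y - x) \<le> f y - f x"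
    "\<forall>\<^sub>F y in nhds x. w \<bullet> (y - x) - \<eta> / 2 * norm (y - x) \<le> g y - g x"
    using assms unfolding frechet_minorant_def by (auto dest: spec[of _ "\<eta> / 2"])
  then show "\<forall>\<^sub>F y in nhds x. (v + w) \<bullet> (y - x) - \<eta> * norm (y - x) \<le> f y + g y - (f x + g x)"
    by eventually_elim (simp add: inner_add_left)
qed

lemma frechet_minorant_sum:
  assumes "finite I" "\<And>i. i \<in> I \<Longrightarrow> frechet_minorant (f i) x (v i)"
  shows "frechet_minorant (\<lambda>y. \<Sum>i\<in>I. f i y) x (\<Sum>i\<in>I. v i)"
  using assms
proof (induction I rule: finite_induct)
  case empty
  then show ?case by (auto intro: frechet_minorant_global)
next
  case (insert i I)
  then show ?case by (simp add: frechet_minorant_add)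
qed

lemma frechet_minorant_fst:
  assumes "frechet_minorant f x v"
  shows "frechet_minorant (\<lambda>w. f (fst w)) (x, u) (v, 0)"
  unfolding frechet_minorant_def
proof (intro allI impI)
  fix \<eta> :: real assume \<eta>: "\<eta> > 0"
  have "filterlim fst (nhds x) (nhds (x, u))"
    using tendsto_fst[of "\<lambda>w. w" "(x, u)" "nhds (x, u)"] by (simp add: filterlim_ident)
  moreover have "\<forall>\<^sub>F y in nhds x. v \<bullet> (y - x) - \<eta> * norm (y - x) \<le> f y - f x"
    using assms \<eta> by (auto simp: frechet_minorant_def)
  ultimately have "\<forall>\<^sub>F w in nhds (x, u). v \<bullet> (fst w - x) - \<eta> * norm (fst w - x) \<le> f (fst w) - f x"
    by (rule eventually_compose_filterlim[rotated])
  then show "\<forall>\<^sub>F w in nhds (x, u). (v, 0) \<bullet> (w - (x, u)) - \<eta> * norm (w - (x, u))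
    \<le> f (fst w) - f (fst (x, u))"
  proof eventually_elim
    case (elim w)
    have "norm (fst w - x) \<le> norm (w - (x, u))" using norm_fst_le[of "fst w - x" "snd w - u"]
      by (cases w) auto
    then have "\<eta> * norm (fst w - x) \<le> \<eta> * norm (w - (x, u))" using \<eta> by simp
    then show ?case using elim by (cases w) (simp add: inner_Pair)
  qed
qed

text \<open>The quadratic is convex in the pair, so its gradient is a global minorant; the error is
  \<open>c / 2\<close> times the squared change of \<open>y - w\<close>.\<close>

lemma frechet_minorant_proximal:
  assumes "frechet_minorant f x v" "0 \<le> c"
  shows "frechet_minorant (\<lambda>(y, w). f y + c / 2 * (norm (y - w))\<^sup>2) (x, u)
    (v + c *\<^sub>R (x - u), - c *\<^sub>R (x - u))"
proof -
  have "frechet_minorant (\<lambda>w. c / 2 * (norm (fst w - snd w))\<^sup>2) (x, u) (c *\<^sub>R (x - u), - c *\<^sub>R (x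
    - u))"
  proof (rule frechet_minorant_global)
    fix w :: "'a \<times> 'a"
    define d where "d = (fst w - snd w) - (x - u)"
    have sq: "(norm (fst w - snd w))\<^sup>2 = (norm (x - u))\<^sup>2 + 2 * ((x - u) \<bullet> d) + (norm d)\<^sup>2"
      unfolding d_def power2_norm_eq_inner by (simp add: inner_diff inner_commute algebra_simps)
    have "c / 2 * (norm (fst w - snd w))\<^sup>2 - c / 2 * (norm (x - u))\<^sup>2
        = c * ((x - u) \<bullet> d) + c / 2 * (norm d)\<^sup>2"
      unfolding sq by (simp add: algebra_simps)
    moreover have "0 \<le> c / 2 * (norm d)\<^sup>2" using assms(2) by simp
    moreover have "(c *\<^sub>R (x - u), - c *\<^sub>R (x - u)) \<bullet> (w - (x, u)) = c * ((x - u) \<bullet> d)"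
      by (cases w) (simp add: inner_Pair d_def inner_diff algebra_simps)
    ultimately show "(c *\<^sub>R (x - u), - c *\<^sub>R (x - u)) \<bullet> (w - (x, u))
        \<le> c / 2 * (norm (fst w - snd w))\<^sup>2 - c / 2 * (norm (fst (x, u) - snd (x, u)))\<^sup>2"
      by simp
  qed
  from frechet_minorant_add[OF frechet_minorant_fst[OF assms(1), of u] this]
  show ?thesis by (simp add: case_prod_beta')
qed

text \<open>The Frechet inequality is tested along the segment from \<open>x\<close> to
  \<open>w\<close>: convexity makes the increment of \<open>h\<close> at most linear in
  \<open>s\<close>, and beyond its gradient the quadratic is of second order. Dividing by
  \<open>s\<close> and letting \<open>s\<close> tend to 0 makes the local inequality global.\<close>

lemma frechet_subgradient_quadratic_plus_convex:
  fixes h :: "'a::euclidean_space \<Rightarrow> real"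
  assumes V: "subspace V" and h: "convex_on V h"
    and l: "l \<in> frechet_subdiff_on V (\<lambda>w. ereal ((w - z) \<bullet> u + \<beta> / 2 * (norm (w - z))\<^sup>2 + h w)) x"
    and w: "w \<in> V"
  shows "h x + (l - u - \<beta> *\<^sub>R (x - z)) \<bullet> (w - x) \<le> h w"
proof (cases "w = x")
  case False
  define D where "D = w - x"
  define e where "e = h w - h x - (l - u - \<beta> *\<^sub>R (x - z)) \<bullet> D"
  have xV: "x \<in> V" using l by (simp add: frechet_subdiff_on_iff)
  have D: "D \<in> V" "D \<noteq> 0" using xV w V False by (auto simp: D_def subspace_diff)
  have "0 \<le> e + \<delta>" if "\<delta> > 0" for \<delta>
  proof -
    \<comment> \<open>Normalised so that the Frechet error along the segment is exactly
      \<open>s * \<delta>\<close>.\<close>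
    define \<eta> where "\<eta> = \<delta> / norm D"
    have \<eta>: "\<eta> > 0" "\<eta> * norm D = \<delta>" using that D by (auto simp: \<eta>_def)
    have lim: "filterlim (\<lambda>s. x + s *\<^sub>R D) (at x within V) (at_right 0)"
      unfolding filterlim_at
    proof
      show "\<forall>\<^sub>F s in at_right 0. x + s *\<^sub>R D \<in> V \<and> x + s *\<^sub>R D \<noteq> x"
        using D xV V by (auto simp: eventually_at_filter subspace_add subspace_scale)
      have "((\<lambda>s. x + s *\<^sub>R D) \<longlongrightarrow> x + 0 *\<^sub>R D) (at_right 0)" by (intro tendsto_intros)
      then show "((\<lambda>s. x + s *\<^sub>R D) \<longlongrightarrow> x) (at_right 0)" by simp
    qed
    have "\<forall>\<^sub>F y in at x within V. l \<bullet> (y - x) - \<eta> * norm (y - x)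
        \<le> ((y - z) \<bullet> u + \<beta> / 2 * (norm (y - z))\<^sup>2 + h y) - ((x - z) \<bullet> u + \<beta> / 2 * (norm (x - z))\<^sup>2
          + h x)"
      using l \<eta>(1) by (simp add: frechet_subdiff_on_iff)
    from eventually_compose_filterlim[OF this lim]
    have "\<forall>\<^sub>F s in at_right 0. l \<bullet> (s *\<^sub>R D) - \<eta> * norm (s *\<^sub>R D)
        \<le> ((x + s *\<^sub>R D - z) \<bullet> u + \<beta> / 2 * (norm (x + s *\<^sub>R D - z))\<^sup>2 + h (x + s *\<^sub>R D))
          - ((x - z) \<bullet> u + \<beta> / 2 * (norm (x - z))\<^sup>2 + h x)"
      by simp
    moreover have "\<forall>\<^sub>F s :: real in at_right 0. 0 < s \<and> s < 1"
      by (auto simp: eventually_at_right_field intro!: exI[of _ 1])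
    ultimately have ev: "\<forall>\<^sub>F s in at_right 0. 0 \<le> e + \<delta> + s * (\<beta> / 2 * (norm D)\<^sup>2)"
    proof eventually_elim
      case (elim s)
      have "h ((1 - s) *\<^sub>R x + s *\<^sub>R w) \<le> (1 - s) * h x + s * h w"
        using convex_onD[OF h, of s x w] elim xV w by simp
      then have hle: "h (x + s *\<^sub>R D) \<le> h x + s * (h w - h x)"
        by (simp add: D_def algebra_simps)
      have N: "(norm (x + s *\<^sub>R D - z))\<^sup>2
          = (norm (x - z))\<^sup>2 + 2 * s * ((x - z) \<bullet> D) + s\<^sup>2 * (norm D)\<^sup>2"
        unfolding power2_norm_eq_inner
        by (simp add: inner_diff inner_add inner_commute algebra_simps power2_eq_square)
      have I: "(x + s *\<^sub>R D - z) \<bullet> u = (x - z) \<bullet> u + s * (u \<bullet> D)"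
        by (simp add: inner_diff inner_add inner_commute algebra_simps)
      have L: "l \<bullet> (s *\<^sub>R D) - \<eta> * norm (s *\<^sub>R D) = s * (l \<bullet> D) - s * \<delta>"
        using \<eta>(2) elim by (simp add: algebra_simps)
      have "s * (l \<bullet> D) - s * \<delta> \<le> s * (u \<bullet> D) + \<beta> * s * ((x - z) \<bullet> D)
          + \<beta> / 2 * s\<^sup>2 * (norm D)\<^sup>2 + s * (h w - h x)"
        using elim(1)[unfolded N I L] hle by (simp add: algebra_simps)
      then have "0 \<le> s * (e + \<delta> + s * (\<beta> / 2 * (norm D)\<^sup>2))"
        by (simp add: e_def inner_diff_left algebra_simps power2_eq_square)
      then show ?case using elim by (simp add: zero_le_mult_iff)
    qed
    have "((\<lambda>s. e + \<delta> + s * (\<beta> / 2 * (norm D)\<^sup>2)) \<longlongrightarrow> e + \<delta> + 0 * (\<beta> / 2 * (norm D)\<^sup>2)) (at_right 0)"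
      by (intro tendsto_intros)
    from tendsto_lowerbound[OF this ev] show ?thesis by simp
  qed
  then have "0 \<le> e" by (rule field_le_epsilon)
  then show ?thesis by (simp add: e_def D_def)
qed simp

text \<open>The global inequality, unlike the Frechet condition, is stable under joint limits of
  base points and subgradients.\<close>

lemma limiting_subgradient_quadratic_plus_convex:
  fixes h :: "'a::euclidean_space \<Rightarrow> real"
  assumes "subspace V" "convex_on V h" "continuous_on UNIV h"
    and l: "l \<in> limiting_subdiff_on V (\<lambda>w. ereal ((w - z) \<bullet> u + \<beta> / 2 * (norm (w - z))\<^sup>2 + h w)) x"
    and "w \<in> V"
  shows "h x + (l - u - \<beta> *\<^sub>R (x - z)) \<bullet> (w - x) \<le> h w"
proof -
  from l obtain X W where X: "X \<longlonglongrightarrow> x" and W: "W \<longlonglongrightarrow> l"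
    and XW: "\<And>j. W j \<in> frechet_subdiff_on V (\<lambda>w. ereal ((w - z) \<bullet> u + \<beta> / 2 * (norm (w - z))\<^sup>2
      + h w)) (X j)"
    unfolding limiting_subdiff_on_def by blast
  have "(\<lambda>j. h (X j)) \<longlonglongrightarrow> h x"
    using assms(3) X by (auto simp: continuous_on_def tendsto_compose)
  then have "(\<lambda>j. h (X j) + (W j - u - \<beta> *\<^sub>R (X j - z)) \<bullet> (w - X j))
      \<longlonglongrightarrow> h x + (l - u - \<beta> *\<^sub>R (x - z)) \<bullet> (w - x)"
    by (intro tendsto_intros X W)
  then show ?thesis
    by (rule LIMSEQ_le_const2)
      (use frechet_subgradient_quadratic_plus_convex[OF assms(1,2) XW assms(5)] in blast)
qed

section \<open>Subvectors as orthogonal projections onto coordinate subspaces\<close>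

lemma subspace_coord_space: "subspace (coord_space I)"
  by (auto simp: subspace_def coord_space_def)

lemma subvec_in_coord_space [simp]: "subvec I x \<in> coord_space I"
  by (simp add: subvec_def coord_space_def)

lemma linear_subvec: "linear (subvec I)"
  by (auto simp: linear_iff subvec_def vec_eq_iff)

lemmas subvec_simps = linear_add[OF linear_subvec] linear_diff[OF linear_subvec]
  linear_0[OF linear_subvec] linear_scale[OF linear_subvec]

lemma subvec_coord_space:
  assumes "u \<in> coord_space I"
  shows "subvec I u = u"
  using assms by (auto simp: subvec_def coord_space_def vec_eq_iff)

lemma subvec_subvec: "subvec I (subvec J x) = subvec (I \<inter> J) x"
  by (auto simp: subvec_def vec_eq_iff)

lemma inner_subvec_coord_space:
  assumes "u \<in> coord_space I"
  shows "u \<bullet> subvec I y = u \<bullet> y"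
  unfolding inner_vec_def using assms by (intro sum.cong) (auto simp: subvec_def coord_space_def)

lemma norm_subvec_le: "norm (subvec I x) \<le> norm x"
proof -
  have "\<bar>subvec I x $ i\<bar> \<le> \<bar>x $ i\<bar>" for i by (simp add: subvec_def)
  then show ?thesis by (intro norm_le_componentwise_cart) simp
qed

lemma sum_subvec_partition:
  assumes "partition_on UNIV G"
  shows "(\<Sum>g\<in>G. subvec g x) = x"
proof -
  have "(\<Sum>g\<in>G. subvec g x) $ i = x $ i" for i
  proof -
    have "i \<in> \<Union>G" using partition_onD1[OF assms] by simp
    then obtain g where g: "g \<in> G" "i \<in> g" by blast
    have "i \<notin> g'" if "g' \<in> G - {g}" for g'
      using assms g that by (auto simp: partition_on_def disjoint_def)
    then have "(\<Sum>g'\<in>G. subvec g' x $ i) = (\<Sum>g'\<in>{g}. subvec g' x $ i)"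
      using g by (intro sum.mono_neutral_right) (auto simp: subvec_def)
    then show ?thesis using g by (simp add: subvec_def)
  qed
  then show ?thesis by (simp add: vec_eq_iff)
qed

lemma sum_inner_subvec_partition:
  assumes "partition_on UNIV G"
  shows "(\<Sum>g\<in>G. subvec g x \<bullet> subvec g y) = x \<bullet> y"
  by (simp add: inner_subvec_coord_space sum_subvec_partition[OF assms] flip: inner_sum_left)

lemma tendsto_subvec: "(f \<longlongrightarrow> l) F \<Longrightarrow> ((\<lambda>j. subvec I (f j)) \<longlongrightarrow> subvec I l) F"
  using linear_conv_bounded_linear linear_subvec bounded_linear.tendsto by blast

text \<open>At a group that vanishes, the infinite slope of the penalty at \<open>0\<close> admits every subgradient.\<close>

lemma frechet_minorant_penalty_zero:
  assumes adm: "admissible_penalty \<psi>" and "p \<ge> 1" "0 < \<alpha>" "subvec g x = 0" "v \<in> coord_space g"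
  shows "frechet_minorant (\<lambda>y. \<alpha> * \<psi> (lp_norm p (subvec g y))) x v"
  unfolding frechet_minorant_def
proof (intro allI impI)
  fix \<eta> :: real assume \<eta>: "\<eta> > 0"
  define K where "K = real CARD('a)"
  \<comment> \<open>With this slope \<open>\<alpha> * \<psi>\<close> dominates \<open>norm v\<close>
    times the Euclidean norm of the group, which is at most \<open>K\<close> times its
    \<open>p\<close>-norm; the \<open>+ 1\<close> keeps the slope positive when
    \<open>v = 0\<close>.\<close>
  obtain \<delta> where \<delta>: "0 < \<delta>"
    "\<And>s. 0 \<le> s \<Longrightarrow> s < \<delta> \<Longrightarrow> (norm v * K + 1) / \<alpha> * s \<le> \<psi> s"
    using penalty_eventually_ge_mult[OF adm, of "(norm v * K + 1) / \<alpha>"] assms(3)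
    by (auto simp: K_def add_nonneg_pos)
  have "((\<lambda>y. lp_norm p (subvec g y)) \<longlongrightarrow> lp_norm p (subvec g x)) (nhds x)"
    by (intro tendsto_lp_norm tendsto_subvec assms filterlim_ident)
  from order_tendstoD(2)[OF this, of \<delta>]
  have "\<forall>\<^sub>F y in nhds x. lp_norm p (subvec g y) < \<delta>" using \<delta> assms by simp
  then show "\<forall>\<^sub>F y in nhds x. v \<bullet> (y - x) - \<eta> * norm (y - x)
      \<le> \<alpha> * \<psi> (lp_norm p (subvec g y)) - \<alpha> * \<psi> (lp_norm p (subvec g x))"
  proof eventually_elim
    case (elim y)
    let ?s = "lp_norm p (subvec g y)"
    have "norm (subvec g y) \<le> (\<Sum>i\<in>UNIV. \<bar>subvec g y $ i\<bar>)" by (rule norm_le_l1_cart)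
    also have "\<dots> \<le> K * ?s"
      unfolding K_def by (intro sum_bounded_above component_le_lp_norm assms)
    finally have n: "norm (subvec g y) \<le> K * ?s" .
    have "v \<bullet> (y - x) = v \<bullet> subvec g (y - x)" using assms by (simp add: inner_subvec_coord_space)
    also have "\<dots> = v \<bullet> subvec g y" using assms by (simp add: subvec_simps)
    also have "\<dots> \<le> norm v * norm (subvec g y)" by (rule norm_cauchy_schwarz)
    also have "\<dots> \<le> norm v * (K * ?s)" using n by (intro mult_left_mono) auto
    also have "\<dots> \<le> (norm v * K + 1) * ?s" using lp_norm_nonneg[of p "subvec g y"]
      by (simp add: algebra_simps)
    also have "\<dots> \<le> \<alpha> * \<psi> ?s"
      using \<delta>(2)[of ?s] elim assms(3) lp_norm_nonneg[of p "subvec g y"] by (simp add: field_simps)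
    finally have "v \<bullet> (y - x) \<le> \<alpha> * \<psi> ?s" .
    moreover have "0 \<le> \<eta> * norm (y - x)" using \<eta> by simp
    moreover have "\<psi> (lp_norm p (subvec g x)) = 0"
      using assms by (simp add: admissible_penalty_def)
    ultimately show ?case by simp
  qed
qed

text \<open>Chain rule: the positive slope of \<open>\<psi>\<close> preserves the convex subgradient
  inequality for the norm. The remainder of \<open>\<psi>\<close> is measured in norm values and
  passed on to \<open>norm (y - x)\<close> by the Lipschitz constant, whence
  \<open>\<eta>' = \<eta> / (\<alpha> * K)\<close>.\<close>

lemma frechet_minorant_penalty_nonzero:
  fixes x :: "real^'n"
  assumes adm: "admissible_penalty \<psi>" and "p \<ge> 1" "0 < \<alpha>" and nz: "subvec g x \<noteq> 0"
    and v: "v \<in> coord_space g"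
    and sub: "\<And>w. w \<in> coord_space g \<Longrightarrow> lp_norm p (subvec g x) + v \<bullet> (w - subvec g x) \<le> lp_norm p w"
  shows "frechet_minorant (\<lambda>y. \<alpha> * \<psi> (lp_norm p (subvec g y))) x
    ((\<alpha> * deriv \<psi> (lp_norm p (subvec g x))) *\<^sub>R v)"
  unfolding frechet_minorant_def
proof (intro allI impI)
  fix \<eta> :: real assume \<eta>: "\<eta> > 0"
  define K where "K = real CARD('n) powr (1 / p)"
  define s where "s y = lp_norm p (subvec g y)" for y
  define \<eta>' where "\<eta>' = \<eta> / (\<alpha> * K)"
  have K: "K > 0" by (simp add: K_def)
  then have \<eta>': "\<eta>' > 0" "\<alpha> * \<eta>' * K = \<eta>" using \<eta> assms(3) by (auto simp: \<eta>'_def)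
  have spos: "s x > 0"
    using lp_norm_nonneg[of p "subvec g x"] nz lp_norm_eq_0_iff[OF assms(2)]
      by (auto simp: s_def less_le)
  then have "(\<psi> has_derivative (\<lambda>d. deriv \<psi> (s x) * d)) (at (s x))"
    using adm by (auto simp: admissible_penalty_def DERIV_deriv_iff_real_differentiable[symmetric]
      has_field_derivative_def)
  then obtain \<delta> where \<delta>: "\<delta> > 0" "\<And>r. \<bar>r - s x\<bar> < \<delta> \<Longrightarrow>
      \<bar>\<psi> r - \<psi> (s x) - deriv \<psi> (s x) * (r - s x)\<bar> \<le> \<eta>' * \<bar>r - s x\<bar>"
    using \<eta>' unfolding has_derivative_at_alt by auto
  have "(s \<longlongrightarrow> s x) (nhds x)"
    unfolding s_def by (intro tendsto_lp_norm tendsto_subvec assms filterlim_ident)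
  from tendstoD[OF this \<delta>(1)]
  have "\<forall>\<^sub>F y in nhds x. \<bar>s y - s x\<bar> < \<delta>" by (simp add: dist_real_def)
  then have "\<forall>\<^sub>F y in nhds x. ((\<alpha> * deriv \<psi> (s x)) *\<^sub>R v) \<bullet> (y - x) - \<eta> * norm (y - x)
      \<le> \<alpha> * \<psi> (s y) - \<alpha> * \<psi> (s x)"
  proof eventually_elim
    case (elim y)
    have "\<bar>s y - s x\<bar> \<le> K * norm (subvec g y - subvec g x)"
      unfolding s_def K_def by (rule lp_norm_diff_le[OF assms(2)])
    also have "\<dots> \<le> K * norm (y - x)"
      using K norm_subvec_le[of g "y - x"] by (simp add: subvec_simps)
    finally have "\<eta>' * \<bar>s y - s x\<bar> \<le> \<eta>' * (K * norm (y - x))" using \<eta>'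
      by (intro mult_left_mono) auto
    moreover have "deriv \<psi> (s x) * (v \<bullet> (y - x)) \<le> deriv \<psi> (s x) * (s y - s x)"
    proof (rule mult_left_mono)
      have "v \<bullet> (y - x) = v \<bullet> (subvec g y - subvec g x)"
        using inner_subvec_coord_space[OF v, of "y - x"] by (simp add: subvec_simps)
      then show "v \<bullet> (y - x) \<le> s y - s x" using sub[of "subvec g y"] by (simp add: s_def)
      show "0 \<le> deriv \<psi> (s x)" using penalty_deriv_pos[OF adm spos] by simp
    qed
    ultimately have "deriv \<psi> (s x) * (v \<bullet> (y - x)) - \<eta>' * (K * norm (y - x)) \<le> \<psi> (s y) - \<psi> (s x)"
      using \<delta>(2)[OF elim] by linarith
    then have "\<alpha> * (deriv \<psi> (s x) * (v \<bullet> (y - x)) - \<eta>' * (K * norm (y - x)))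
      \<le> \<alpha> * (\<psi> (s y) - \<psi> (s x))"
      using assms(3) by simp
    moreover have "\<alpha> * (\<eta>' * (K * norm (y - x))) = \<eta> * norm (y - x)" using \<eta>'(2)
      by (metis mult.assoc)
    ultimately show ?case unfolding right_diff_distrib inner_scaleR_left mult.assoc by linarith
  qed
  then show "\<forall>\<^sub>F y in nhds x. ((\<alpha> * deriv \<psi> (lp_norm p (subvec g x))) *\<^sub>R v) \<bullet> (y - x)
    - \<eta> * norm (y - x)
      \<le> \<alpha> * \<psi> (lp_norm p (subvec g y)) - \<alpha> * \<psi> (lp_norm p (subvec g x))"
    by (simp add: s_def)
qed

section \<open>The KL property\<close>

text \<open>Extended-real data shrink to a real \<open>\<sigma>\<close> and a ball, concavity of
  \<open>\<phi>\<close> becomes its tangent inequality, and the distance to the subdifferential is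
  replaced by the norm of any Frechet minorant, which bounds the infimum from above.\<close>

lemma KL_property_at_realE:
  fixes F :: "'a::euclidean_space \<Rightarrow> real"
  assumes "KL_property_at (\<lambda>v. ereal (F v)) vbar"
  obtains \<sigma> \<rho> :: real and \<phi> :: "real \<Rightarrow> real" where "0 < \<sigma>" "0 < \<rho>"
    "continuous_on {0..<\<sigma>} \<phi>" "\<phi> 0 = 0"
    "\<And>s. 0 \<le> s \<Longrightarrow> s < \<sigma> \<Longrightarrow> 0 \<le> \<phi> s"
    "\<And>s. 0 < s \<Longrightarrow> s < \<sigma> \<Longrightarrow> 0 < deriv \<phi> s"
    "\<And>s s'. 0 < s \<Longrightarrow> s < \<sigma> \<Longrightarrow> 0 \<le> s' \<Longrightarrow> s' < \<sigma> \<Longrightarrow> deriv \<phi> s * (s - s') \<le> \<phi> s - \<phi> s'"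
    "\<And>v w. v \<in> ball vbar \<rho> \<Longrightarrow> 0 < F v - F vbar \<Longrightarrow> F v - F vbar < \<sigma> \<Longrightarrow>
      frechet_minorant F v w \<Longrightarrow> 1 \<le> deriv \<phi> (F v - F vbar) * norm w"
  using assms unfolding KL_property_at_def
proof (elim exE conjE)
  fix \<sigma>\<^sub>0 :: ereal and U and \<phi> :: "real \<Rightarrow> real"
  assume \<sigma>\<^sub>0: "0 < \<sigma>\<^sub>0" and U: "open U" "vbar \<in> U"
    and nonneg: "\<forall>s. 0 \<le> s \<and> ereal s < \<sigma>\<^sub>0 \<longrightarrow> 0 \<le> \<phi> s"
    and cont: "continuous_on {s. 0 \<le> s \<and> ereal s < \<sigma>\<^sub>0} \<phi>"
    and conc: "concave_on {s. 0 \<le> s \<and> ereal s < \<sigma>\<^sub>0} \<phi>"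
    and zero: "\<phi> 0 = 0"
    and diff: "\<forall>s. 0 < s \<and> ereal s < \<sigma>\<^sub>0 \<longrightarrow> \<phi> differentiable (at s)"
    and deriv_pos: "\<forall>s. 0 < s \<and> ereal s < \<sigma>\<^sub>0 \<longrightarrow> 0 < deriv \<phi> s"
    and KL: "\<forall>v\<in>U. ereal (F vbar) < ereal (F v) \<and> ereal (F v) < ereal (F vbar) + \<sigma>\<^sub>0 \<longrightarrow>
       1 \<le> ereal (deriv \<phi> (real_of_ereal (ereal (F v) - ereal (F vbar))))
         * (INF \<xi>\<in>limiting_subdiff (\<lambda>v. ereal (F v)) v. ereal (norm \<xi>))"
  obtain \<sigma> where \<sigma>: "0 < \<sigma>" "ereal \<sigma> < \<sigma>\<^sub>0" using ereal_dense2[OF \<sigma>\<^sub>0] by auto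
  have below: "ereal s < \<sigma>\<^sub>0" if "s < \<sigma>" for s
    using \<sigma>(2) that less_trans[of "ereal s" "ereal \<sigma>" \<sigma>\<^sub>0] by simp
  have sub: "{0..<\<sigma>} \<subseteq> {s. 0 \<le> s \<and> ereal s < \<sigma>\<^sub>0}" using below by auto
  obtain \<rho> where \<rho>: "0 < \<rho>" "ball vbar \<rho> \<subseteq> U" using U by (meson open_contains_ball)
  show ?thesis
  proof (rule that[of \<sigma> \<rho> \<phi>])
    show "continuous_on {0..<\<sigma>} \<phi>" using cont sub by (rule continuous_on_subset)
    have conc': "concave_on {0..<\<sigma>} \<phi>"
      using conc sub unfolding concave_on_def by (rule convex_on_subset) simp
    fix s s' :: real assume s: "0 < s" "s < \<sigma>" "0 \<le> s'" "s' < \<sigma>"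
    have "{0<..<\<sigma>} \<subseteq> interior {0..<\<sigma>}" by (intro interior_maximal) auto
    then have "\<phi> s' \<le> \<phi> s + deriv \<phi> s * (s' - s)"
      using s below diff by (intro concave_on_tangent[OF conc']) auto
    then show "deriv \<phi> s * (s - s') \<le> \<phi> s - \<phi> s'" by (simp add: algebra_simps)
  next
    fix v w assume v: "v \<in> ball vbar \<rho>" "0 < F v - F vbar" "F v - F vbar < \<sigma>"
      and w: "frechet_minorant F v w"
    have "ereal (F v) < ereal (F vbar) + \<sigma>\<^sub>0" using below[OF v(3)] by (cases \<sigma>\<^sub>0) auto
    then have "1 \<le> ereal (deriv \<phi> (F v - F vbar))
        * (INF \<xi>\<in>limiting_subdiff (\<lambda>v. ereal (F v)) v. ereal (norm \<xi>))"
      using KL[rule_format, of v] v \<rho> by auto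
    also have "\<dots> \<le> ereal (deriv \<phi> (F v - F vbar)) * ereal (norm w)"
      using deriv_pos[rule_format, of "F v
        - F vbar"] v(2) below[OF v(3)] frechet_minorant_imp_limiting[OF w]
      by (intro ereal_mult_left_mono INF_lower) auto
    finally show "1 \<le> deriv \<phi> (F v - F vbar) * norm w" by simp
  qed (use \<sigma> \<rho> nonneg zero deriv_pos below in auto)
qed

lemma convergent_of_summable_steps:
  fixes x :: "nat \<Rightarrow> 'a::banach"
  assumes "summable (\<lambda>k. norm (x (Suc k) - x k))"
  shows "convergent x"
proof -
  have "(\<lambda>n. \<Sum>k<n. x (Suc k) - x k) \<longlonglongrightarrow> (\<Sum>k. x (Suc k) - x k)"
    by (rule summable_LIMSEQ[OF summable_norm_cancel[OF assms]])
  then have "(\<lambda>n. x n - x 0) \<longlonglongrightarrow> (\<Sum>k. x (Suc k) - x k)"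
    by (simp add: sum_lessThan_telescope)
  from tendsto_add[OF this tendsto_const[of "x 0"]] show ?thesis
    by (auto simp: convergent_def)
qed

text \<open>The decrease is attached to the older of the two steps, so the drop of \<open>h\<close>
  from \<open>k\<close> to \<open>Suc k\<close> controls \<open>norm (y (Suc k) - y k)\<close>.
  Continuity of \<open>F\<close> is demanded only along sequences of iterates, as the energy offers
  no more.\<close>

lemma KL_proximal_descent:
  fixes F :: "'a::euclidean_space \<Rightarrow> real" and y v :: "nat \<Rightarrow> 'a"
  assumes c: "0 < c" "0 < c'" and C: "0 < C"
    and F_nonneg: "\<And>u. 0 \<le> F u" and F_bdd: "\<And>M. bounded {u. F u \<le> M}"
    and F_lim: "\<And>u l. (\<And>j. u j \<in> range y) \<Longrightarrow> u \<longlonglongrightarrow> l \<Longrightarrow> (\<lambda>j. F (u j)) \<longlonglongrightarrow> F l"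
    and descent: "\<And>k. F (y (Suc (Suc k))) + c / 2 * (norm (y (Suc (Suc k)) - y (Suc k)))\<^sup>2
        + c' * (norm (y (Suc k) - y k))\<^sup>2
      \<le> F (y (Suc k)) + c / 2 * (norm (y (Suc k) - y k))\<^sup>2"
    and v_sub: "\<And>k. frechet_minorant F (y (Suc (Suc k))) (v k)"
    and v_bound: "\<And>k. norm (v k) \<le> C * (norm (y (Suc (Suc k)) - y (Suc k))
      + norm (y (Suc k) - y k))"
    and KL: "KL_function (\<lambda>(v, u). ereal (F v + c / 2 * (norm (v - u))\<^sup>2))"
  shows "\<exists>ybar. y \<longlonglongrightarrow> ybar \<and> 0 \<in> limiting_subdiff (\<lambda>v. ereal (F v)) ybar"
    and "summable (\<lambda>k. norm (y (Suc k) - y k))"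
proof -
  define H where "H = (\<lambda>(v, u). F v + c / 2 * (norm (v - u))\<^sup>2)"
  define a where "a k = norm (y (Suc k) - y k)" for k
  define h where "h k = H (y (Suc k), y k)" for k
  define w where "w k = (v k + c *\<^sub>R (y (Suc (Suc k)) - y (Suc k)), - c *\<^sub>R (y (Suc (Suc k))
    - y (Suc k)))" for k
  have h: "h k = F (y (Suc k)) + c / 2 * (a k)\<^sup>2" for k by (simp add: h_def H_def a_def)
  have h_desc: "h (Suc k) + c' * (a k)\<^sup>2 \<le> h k" for k
    using descent[of k] by (simp add: h a_def)
  have h_nonneg: "0 \<le> h k" for k using F_nonneg[of "y (Suc k)"] c by (simp add: h)
  have "decseq h"
  proof (rule decseq_SucI)
    fix k
    have "0 \<le> c' * (a k)\<^sup>2" using c by simp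
    then show "h (Suc k) \<le> h k" using h_desc[of k] by linarith
  qed
  then obtain hlim where hlim: "h \<longlonglongrightarrow> hlim" "\<And>k. hlim \<le> h k"
    by (rule decseq_convergent[of h 0]) (use h_nonneg in auto)
  have a_lim: "a \<longlonglongrightarrow> 0"
  proof -
    have "(\<lambda>k. (h k - h (Suc k)) / c') \<longlonglongrightarrow> (hlim - hlim) / c'"
      using c by (intro tendsto_intros hlim LIMSEQ_Suc) auto
    then have lim: "(\<lambda>k. (h k - h (Suc k)) / c') \<longlonglongrightarrow> 0" by simp
    have "\<forall>\<^sub>F k in sequentially. norm ((a k)\<^sup>2) \<le> (h k - h (Suc k)) / c'"
    proof (rule always_eventually, rule allI)
      fix k
      show "norm ((a k)\<^sup>2) \<le> (h k - h (Suc k)) / c'"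
        using h_desc[of k] c by (simp add: field_simps)
    qed
    from Lim_null_comparison[OF this lim] show ?thesis by simp
  qed
  have "range (\<lambda>k. y (Suc k)) \<subseteq> {u. F u \<le> h 0}"
  proof clarsimp
    fix k
    have "0 \<le> c / 2 * (a k)\<^sup>2" using c by simp
    moreover have "h k \<le> h 0" using \<open>decseq h\<close> by (simp add: decseq_def)
    ultimately show "F (y (Suc k)) \<le> h 0" using h[of k] by linarith
  qed
  then have bdd: "bounded (range (\<lambda>k. y (Suc k)))" by (rule bounded_subset[OF F_bdd])
  obtain ybar r where r: "strict_mono r" "((\<lambda>k. y (Suc k)) \<circ> r) \<longlonglongrightarrow> ybar"
    using bounded_imp_convergent_subsequence[OF bdd] by blast
  have a_r: "(\<lambda>j. a (s j)) \<longlonglongrightarrow> 0" if "\<And>j. r j \<le> s j" for s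
  proof (rule filterlim_compose[OF a_lim])
    show "filterlim s at_top sequentially"
      using that by (intro filterlim_at_top_mono[OF filterlim_subseq[OF r(1)]] always_eventually) simp
  qed
  \<comment> \<open>Vanishing steps give \<open>y (r j)\<close> and its next two successors the same
    limit, so pairs of consecutive iterates converge to \<open>(ybar, ybar)\<close>.\<close>
  have step_lim: "(\<lambda>j. y (s j)) \<longlonglongrightarrow> l \<longleftrightarrow> (\<lambda>j. y (Suc (s j))) \<longlonglongrightarrow> l" if "\<And>j. r j \<le> s j" for s l
  proof -
    have d: "(\<lambda>j. y (Suc (s j)) - y (s j)) \<longlonglongrightarrow> 0"
      using a_r[OF that] unfolding a_def by (rule tendsto_norm_zero_cancel)
    show ?thesis by (rule iffI) (rule Lim_transform[OF _ d] Lim_transform2[OF _ d], assumption)+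
  qed
  have y1: "(\<lambda>j. y (Suc (r j))) \<longlonglongrightarrow> ybar" using r(2) by (simp add: o_def)
  then have y0: "(\<lambda>j. y (r j)) \<longlonglongrightarrow> ybar" using step_lim[of r] by simp
  have y2: "(\<lambda>j. y (Suc (Suc (r j)))) \<longlonglongrightarrow> ybar" using step_lim[of "\<lambda>j. Suc (r j)"] y1
    by (simp add: le_SucI)
  have F2: "(\<lambda>j. F (y (Suc (Suc (r j))))) \<longlonglongrightarrow> F ybar" by (rule F_lim[OF _ y2]) simp
  have "(\<lambda>j. F (y (Suc (Suc (r j)))) + c / 2 * (a (Suc (r j)))\<^sup>2) \<longlonglongrightarrow> F ybar + c / 2 * 0\<^sup>2"
    by (intro tendsto_intros F2 a_r) simp
  then have H2: "(\<lambda>j. h (Suc (r j))) \<longlonglongrightarrow> H (ybar, ybar)" by (simp add: h H_def)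
  moreover have "(\<lambda>j. h (Suc (r j))) \<longlonglongrightarrow> hlim"
    using LIMSEQ_subseq_LIMSEQ[OF LIMSEQ_Suc[OF hlim(1)] r(1)] by (simp add: o_def)
  \<comment> \<open>Hence \<open>h k - hlim\<close> is the gap that enters the KL inequality at the
    cluster pair.\<close>
  ultimately have hlim_eq: "H (ybar, ybar) = hlim" by (rule LIMSEQ_unique)
  have w_sub: "frechet_minorant H (y (Suc (Suc k)), y (Suc k)) (w k)" for k
    unfolding H_def w_def using c by (intro frechet_minorant_proximal v_sub) auto
  have w_bound: "norm (w k) \<le> (C + 2 * c) * (a (Suc k) + a k)" for k
  proof -
    have "norm (w k) \<le> norm (v k + c *\<^sub>R (y (Suc (Suc k)) - y (Suc k)))
      + norm (- c *\<^sub>R (y (Suc (Suc k)) - y (Suc k)))"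
      unfolding w_def by (rule norm_Pair_le)
    also have "\<dots> \<le> (norm (v k) + c * a (Suc k)) + c * a (Suc k)"
      using norm_triangle_ineq[of "v k" "c *\<^sub>R (y (Suc (Suc k)) - y (Suc k))"] c
        by (simp add: a_def)
    also have "\<dots> \<le> C * (a (Suc k) + a k) + 2 * c * (a (Suc k) + a k)"
    proof -
      have "c * a (Suc k) + c * a (Suc k) \<le> 2 * c * (a (Suc k) + a k)" using c by (simp add: a_def)
      then show ?thesis using v_bound[of k] unfolding a_def by linarith
    qed
    finally show ?thesis by (simp add: distrib_right)
  qed
  have lim0: "(\<lambda>j. D * (a (Suc (r j)) + a (r j))) \<longlonglongrightarrow> 0" for D
  proof -
    have "(\<lambda>j. a (Suc (r j)) + a (r j)) \<longlonglongrightarrow> 0 + 0" by (intro tendsto_add a_r) simp_all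
    from tendsto_mult_left[OF this, of D] show ?thesis by simp
  qed
  have "(\<lambda>j. w (r j)) \<longlonglongrightarrow> 0"
    by (rule Lim_null_comparison[OF _ lim0]) (rule always_eventually, rule allI, rule w_bound)
  \<comment> \<open>The KL property is granted only at points with a nonempty subdifferential, so
    criticality of the cluster pair has to be settled first.\<close>
  then have "0 \<in> limiting_subdiff (\<lambda>v. ereal (H v)) (ybar, ybar)"
    by (intro limiting_subdiff_seqI[of "\<lambda>j. (y (Suc (Suc (r j))), y (Suc (r j)))" _ _ "\<lambda>j. w (r j)"]
      tendsto_Pair y1 y2 w_sub) (use H2 in \<open>simp_all add: h_def\<close>)
  then have KL_at: "KL_property_at (\<lambda>v. ereal (H v)) (ybar, ybar)"
    using KL[unfolded KL_function_def] unfolding H_def by (simp only: case_prod_beta') blast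
  obtain \<sigma> \<rho> \<phi> where \<sigma>: "0 < \<sigma>" and \<rho>: "0 < \<rho>"
    and cont: "continuous_on {0..<\<sigma>} \<phi>" and zero: "\<phi> 0 = 0"
    and nonneg: "\<And>s. 0 \<le> s \<Longrightarrow> s < \<sigma> \<Longrightarrow> 0 \<le> \<phi> s"
    and deriv_pos: "\<And>s. 0 < s \<Longrightarrow> s < \<sigma> \<Longrightarrow> 0 < deriv \<phi> s"
    and tangent: "\<And>s s'. 0 < s \<Longrightarrow> s < \<sigma> \<Longrightarrow> 0 \<le> s' \<Longrightarrow> s' < \<sigma> \<Longrightarrow> deriv \<phi> s * (s - s') \<le> \<phi> s - \<phi> s'"
    and KL_ineq: "\<And>v w. v \<in> ball (ybar, ybar) \<rho> \<Longrightarrow> 0 < H v - hlim \<Longrightarrow> H v - hlim < \<sigma> \<Longrightarrow>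
      frechet_minorant H v w \<Longrightarrow> 1 \<le> deriv \<phi> (H v - hlim) * norm w"
    by (rule KL_property_at_realE[OF KL_at, unfolded hlim_eq]) (rule that)
  define g where "g k = h k - hlim" for k
  have g_lim: "g \<longlonglongrightarrow> 0" using tendsto_diff[OF hlim(1) tendsto_const[of hlim]]
    by (simp add: g_def[abs_def])
  have g_nonneg: "0 \<le> g k" for k using hlim(2)[of k] by (simp add: g_def)
  show summable: "summable (\<lambda>k. norm (y (Suc k) - y k))"
  \<comment> \<open>The radius is halved because the KL ball lies in the product space, where the
    distance of pairs is at most the sum of the two distances.\<close>
  proof (rule KL_descent_summable[where h = g and c = c' and C = "C + 2 * c" and \<rho> = "\<rho> / 2"
        and \<sigma> = \<sigma> and \<phi> = \<phi> and \<phi>' = "deriv \<phi>" and r = r and ybar = ybar])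
    show "(\<lambda>k. \<phi> (g k)) \<longlonglongrightarrow> 0"
    proof -
      have "\<forall>\<^sub>F k in sequentially. g k \<in> {0..<\<sigma>}"
        using order_tendstoD(2)[OF g_lim \<sigma>] by eventually_elim (simp add: g_nonneg)
      from continuous_on_tendsto_compose[OF cont g_lim _ this] \<sigma> zero show ?thesis by simp
    qed
    show "g (Suc k) + c' * (norm (y (Suc k) - y k))\<^sup>2 \<le> g k" for k
      using h_desc[of k] by (simp add: g_def a_def)
    show "(y \<circ> r) \<longlonglongrightarrow> ybar" using y0 by (simp add: o_def)
    fix k assume k: "0 < g (Suc k)" "g (Suc k) < \<sigma>"
      "y (Suc k) \<in> ball ybar (\<rho> / 2)" "y (Suc (Suc k)) \<in> ball ybar (\<rho> / 2)"
    have "dist (ybar, ybar) (y (Suc (Suc k)), y (Suc k))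
      \<le> dist ybar (y (Suc (Suc k))) + dist ybar (y (Suc k))"
      unfolding dist_Pair_Pair by (rule sqrt_sum_squares_le_sum) auto
    then have "(y (Suc (Suc k)), y (Suc k)) \<in> ball (ybar, ybar) \<rho>" using k(3,4) by simp
    then have "1 \<le> deriv \<phi> (g (Suc k)) * norm (w k)"
      using k KL_ineq[OF _ _ _ w_sub[of k]] by (simp add: g_def h_def)
    also have "\<dots> \<le> deriv \<phi> (g (Suc k)) * ((C + 2 * c) * (a (Suc k) + a k))"
      using deriv_pos[OF k(1,2)] w_bound[of k] by (intro mult_left_mono) auto
    finally show "1 \<le> deriv \<phi> (g (Suc k)) * ((C + 2 * c) * (norm (y (Suc (Suc k)) - y (Suc k))
      + norm (y (Suc k) - y k)))"
      by (simp add: a_def)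
  next
    show "0 < C + 2 * c" using c C by simp
    show "0 < \<rho> / 2" using \<rho> by simp
  qed (fact c \<sigma> g_nonneg g_lim r(1) nonneg deriv_pos tangent)+
  obtain l where l: "y \<longlonglongrightarrow> l" using convergent_of_summable_steps[OF summable]
    by (auto simp: convergent_def)
  then have "(\<lambda>j. y (r j)) \<longlonglongrightarrow> l" using LIMSEQ_subseq_LIMSEQ[OF l r(1)] by (simp add: o_def)
  then have "l = ybar" using y0 by (rule LIMSEQ_unique)
  moreover have "(\<lambda>j. v (r j)) \<longlonglongrightarrow> 0"
    by (rule Lim_null_comparison[OF _ lim0])
      (rule always_eventually, rule allI, unfold a_def, rule v_bound)
  then have "0 \<in> limiting_subdiff (\<lambda>v. ereal (F v)) ybar"
    by (intro limiting_subdiff_seqI[OF y2 F2 _ v_sub])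
  ultimately show "\<exists>ybar. y \<longlonglongrightarrow> ybar \<and> 0 \<in> limiting_subdiff (\<lambda>v. ereal (F v)) ybar"
    by (intro exI[of _ ybar] conjI) (use l in simp_all)
qed

section \<open>The iteration\<close>

lemma norm_matrix_vector_le_gram:
  fixes A :: "real^'n^'m"
  shows "(norm (A *v d))\<^sup>2 \<le> spectral_norm (transpose A ** A) * (norm d)\<^sup>2"
proof -
  have "(norm (A *v d))\<^sup>2 = d \<bullet> ((transpose A ** A) *v d)"
    unfolding power2_norm_eq_inner
    by (metis dot_lmul_matrix inner_commute matrix_vector_mul_assoc transpose_matrix_vector)
  also have "\<dots> \<le> norm d * norm ((transpose A ** A) *v d)" by (rule norm_cauchy_schwarz)
  also have "\<dots> \<le> norm d * (spectral_norm (transpose A ** A) * norm d)"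
    unfolding spectral_norm_def by (intro mult_left_mono onorm matrix_vector_mul_bounded_linear) auto
  finally show ?thesis by (simp add: power2_eq_square algebra_simps)
qed

text \<open>Exact second-order expansion: bounding the last term gives the descent estimate,
  dropping it gives the gradient as a global minorant.\<close>

lemma half_norm_expansion:
  fixes A :: "real^'n^'m"
  shows "1/2 * (norm (A *v y - b))\<^sup>2 = 1/2 * (norm (A *v x - b))\<^sup>2
    + (transpose A *v (A *v x - b)) \<bullet> (y - x) + 1/2 * (norm (A *v (y - x)))\<^sup>2"
proof -
  define r where "r = A *v x - b"
  define d where "d = A *v (y - x)"
  have "A *v y - b = r + d" by (simp add: r_def d_def matrix_vector_mult_diff_distrib)
  moreover have "(transpose A *v (A *v x - b)) \<bullet> (y - x) = r \<bullet> d"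
    by (simp add: r_def d_def dot_lmul_matrix)
  ultimately show ?thesis
    unfolding r_def[symmetric] d_def[symmetric] power2_norm_eq_inner
    by (simp add: inner_add inner_commute algebra_simps)
qed

lemma spectral_norm_gram_pos:
  fixes A :: "real^'n^'m"
  assumes "A \<noteq> 0"
  shows "0 < spectral_norm (transpose A ** A)"
proof -
  obtain d where "A *v d \<noteq> 0" using assms by (metis matrix_eq matrix_vector_mult_0)
  then have "0 < (norm (A *v d))\<^sup>2" by simp
  also have "\<dots> \<le> spectral_norm (transpose A ** A) * (norm d)\<^sup>2" by (rule norm_matrix_vector_le_gram)
  finally show ?thesis by (simp add: zero_less_mult_iff)
qed

text \<open>\<open>t_bar\<close> is the positive root of \<open>L * s\<^sup>2 + (\<beta> - L) * s =
  \<beta> * (1 - \<epsilon>)\<close>, and \<open>D\<close> is the discriminant. At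
  \<open>s = 1\<close> the left side already equals \<open>\<beta>\<close>, so the root is at most
  1.\<close>

lemma t_bar_bounds:
  fixes A :: "real^'n^'m"
  defines "L \<equiv> spectral_norm (transpose A ** A)"
  assumes "0 < L" "L < \<beta>" "0 \<le> \<epsilon>" "\<epsilon> < 1" "0 \<le> s" "s < t_bar A \<beta> \<epsilon>"
  shows "L * s\<^sup>2 + (\<beta> - L) * s < \<beta> * (1 - \<epsilon>)" and "s < 1"
proof -
  define D where "D = (\<beta> + L)\<^sup>2 - 4 * \<beta> * \<epsilon> * L"
  have D: "D = (\<beta> - L)\<^sup>2 + 4 * L * (\<beta> * (1 - \<epsilon>))"
    by (simp add: D_def power2_eq_square algebra_simps)
  have "0 \<le> 4 * L * (\<beta> * (1 - \<epsilon>))" using assms(2-5) by simp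
  then have D0: "0 \<le> D" unfolding D by simp
  have "2 * L * s + (\<beta> - L) < sqrt D"
    using assms(2,7) by (simp add: t_bar_def Let_def field_simps D_def flip: L_def)
  then have "(2 * L * s + (\<beta> - L))\<^sup>2 < (sqrt D)\<^sup>2"
    using assms(2-6) by (intro power_strict_mono) auto
  then have "4 * L * (L * s\<^sup>2 + (\<beta> - L) * s) < 4 * L * (\<beta> * (1 - \<epsilon>))"
    using D0 unfolding D by (simp add: power2_eq_square algebra_simps)
  then show *: "L * s\<^sup>2 + (\<beta> - L) * s < \<beta> * (1 - \<epsilon>)" using assms(2) by simp
  show "s < 1"
  proof (rule ccontr)
    assume "\<not> s < 1"
    then have "1 \<le> s" "1 \<le> s\<^sup>2" by auto
    then have "L * 1 + (\<beta> - L) * 1 \<le> L * s\<^sup>2 + (\<beta> - L) * s"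
      using assms(2,3) by (intro add_mono mult_left_mono) auto
    moreover have "\<beta> * (1 - \<epsilon>) \<le> \<beta> * 1" using assms(2-4) by (intro mult_left_mono) auto
    ultimately show False using * by simp
  qed
qed

section \<open>Thresholding and the stable support\<close>

lemma subvec_Union:
  assumes "partition_on UNIV G" "\<And>g. g \<in> G - S \<Longrightarrow> subvec g u = 0"
  shows "subvec (\<Union>S) u = u"
proof -
  have "u $ i = 0" if "i \<notin> \<Union>S" for i
  proof -
    have "i \<in> \<Union>G" using partition_onD1[OF assms(1)] by simp
    then obtain g where g: "g \<in> G" "i \<in> g" by blast
    then have "subvec g u $ i = 0" using assms(2)[of g] that by auto
    then show ?thesis using g by (simp add: subvec_def)
  qed
  then show ?thesis by (auto simp: subvec_def vec_eq_iff)
qed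

text \<open>Positivity of \<open>\<tau>\<close> makes the kept groups nonzero, and disjointness
  keeps them from leaving traces in the discarded ones.\<close>

lemma group_supp_threshold:
  assumes "partition_on UNIV G" "0 < \<tau>"
  shows "group_supp G (group_threshold G p \<tau> x) = {g \<in> G. \<tau> \<le> lp_norm p (subvec g x)}"
proof -
  define S where "S = {g \<in> G. \<tau> \<le> lp_norm p (subvec g x)}"
  have "subvec g (subvec (\<Union>S) x) \<noteq> 0 \<longleftrightarrow> g \<in> S" if g: "g \<in> G" for g
  proof (cases "g \<in> S")
    case True
    then have "g \<inter> \<Union>S = g" by auto
    moreover have "subvec g x \<noteq> 0" using True assms(2) by (auto simp: S_def)
    ultimately show ?thesis using True by (simp add: subvec_subvec)
  next
    case False
    have "g \<inter> g' = {}" if "g' \<in> S" for g'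
    proof -
      have "g \<noteq> g'" "g' \<in> G" using that False by (auto simp: S_def)
      then show ?thesis using disjointD[OF partition_onD2[OF assms(1)] g] by blast
    qed
    then have "g \<inter> \<Union>S = {}" by auto
    then show ?thesis using False by (simp add: subvec_subvec) (simp add: subvec_def vec_eq_iff)
  qed
  then show ?thesis
    unfolding group_supp_def group_threshold_def S_def[symmetric] by (auto simp: S_def)
qed

text \<open>
  Thresholding can only shrink the set of active groups, so it eventually becomes constant; from
  then on thresholding does not change the iterates.
\<close>

lemma FITS3_support_stabilizes:
  fixes x :: "nat \<Rightarrow> real^'n" and A :: "real^'n^'m"
  assumes part: "partition_on UNIV G" and \<tau>: "0 < \<tau>"
    and seq: "FITS3_sequence A b \<alpha> p \<psi> G \<beta> \<tau> \<epsilon> t x"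
  obtains N S where "S \<subseteq> G"
    "\<And>k g. N \<le> k \<Longrightarrow> g \<in> S \<Longrightarrow> \<tau> \<le> lp_norm p (subvec g (x k))"
    "\<And>k g. N \<le> k \<Longrightarrow> g \<in> G - S \<Longrightarrow> subvec g (x k) = 0"
    "\<And>k g. N \<le> k \<Longrightarrow> g \<in> S \<Longrightarrow>
      \<exists>l\<in>limiting_subdiff_on (coord_space g)
          (\<lambda>w. ereal (subproblem A b \<alpha> p \<psi> \<beta> (x (Suc k))
             (x (Suc k) + t (Suc k) *\<^sub>R (x (Suc k) - x k)) g w)) (subvec g (x (Suc (Suc k)))).
        norm l \<le> \<beta> * \<epsilon> / 2 * norm (subvec g (x (Suc (Suc k))) - subvec g (x (Suc k)))"
proof -
  define T where "T k = {g \<in> G. \<tau> \<le> lp_norm p (subvec g (x k))}" for k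
  define xt where "xt k = group_threshold G p \<tau> (x k)" for k
  have supp: "group_supp G (xt k) = T k" for k
    unfolding xt_def T_def by (rule group_supp_threshold[OF part \<tau>])
  have step: "(\<forall>g\<in>G - T k. subvec g (x (Suc k)) = 0) \<and>
      (\<forall>g\<in>T k. \<exists>l\<in>limiting_subdiff_on (coord_space g)
          (\<lambda>w. ereal (subproblem A b \<alpha> p \<psi> \<beta> (xt k)
            (subvec (\<Union>(T k)) (xt k + t k *\<^sub>R (xt k - (if k = 0 then x 0 else xt (k - 1))))) g w))
          (subvec g (x (Suc k))).
        norm l \<le> \<beta> * \<epsilon> / 2 * norm (subvec g (x (Suc k)) - subvec g (xt k)))" for k
    using seq unfolding FITS3_sequence_def Let_def supp[symmetric] xt_def by blast
  have dec: "T (Suc k) \<subseteq> T k" for k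
  proof
    fix g assume g: "g \<in> T (Suc k)"
    then have "subvec g (x (Suc k)) \<noteq> 0" using \<tau> by (auto simp: T_def)
    moreover have "g \<in> G" using g by (simp add: T_def)
    ultimately show "g \<in> T k" using step[of k] by blast
  qed
  have dec': "T m \<subseteq> T n" if "n \<le> m" for m n
    using that by (induction m rule: dec_induct) (use dec in blast)+
  \<comment> \<open>A decreasing chain of finite sets cannot shrink after an index of least
    cardinality.\<close>
  obtain n where n: "\<And>m. card (T n) \<le> card (T m)"
    using ex_has_least_nat[of "\<lambda>_. True" 0 "\<lambda>m. card (T m)"] by auto
  have const: "T m = T n" if "n \<le> m" for m
    using card_subset_eq[of "T n" "T m"] dec'[OF that] n[of m] card_mono[of "T n" "T m"] by simp
  \<comment> \<open>This starts at \<open>Suc n\<close>: the iterate \<open>x n\<close> may still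
    carry small nonzero groups, which its thresholding removes.\<close>
  have zero: "subvec g (x k) = 0" if "Suc n \<le> k" "g \<in> G - T n" for k g
    using step[of "k - 1"] const[of "k - 1"] that by (cases k) auto
  have fix_thr: "xt k = x k" if "Suc n \<le> k" for k
  proof -
    have "xt k = subvec (\<Union>(T n)) (x k)"
      using const[of k] that by (simp add: xt_def group_threshold_def T_def)
    then show ?thesis using subvec_Union[OF part zero[OF that]] by simp
  qed
  show ?thesis
  proof (rule that[of "T n" "Suc n"])
    show "T n \<subseteq> G" by (auto simp: T_def)
    show "\<tau> \<le> lp_norm p (subvec g (x k))" if "Suc n \<le> k" "g \<in> T n" for k g
      using const[of k] that by (auto simp: T_def)
    show "subvec g (x k) = 0" if "Suc n \<le> k" "g \<in> G - T n" for k g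
      using zero that by blast
    show "\<exists>l\<in>limiting_subdiff_on (coord_space g)
          (\<lambda>w. ereal (subproblem A b \<alpha> p \<psi> \<beta> (x (Suc k))
             (x (Suc k) + t (Suc k) *\<^sub>R (x (Suc k) - x k)) g w)) (subvec g (x (Suc (Suc k)))).
        norm l \<le> \<beta> * \<epsilon> / 2 * norm (subvec g (x (Suc (Suc k))) - subvec g (x (Suc k)))"
      if k: "Suc n \<le> k" "g \<in> T n" for k g
    proof -
      \<comment> \<open>Thresholding fixes both \<open>x (Suc k)\<close> and \<open>x k\<close>, and
        \<open>Suc k\<close> is positive, so the extrapolation uses two genuine iterates and not the
        convention for step -1.\<close>
      have "subvec (\<Union>(T n)) (x (Suc k) + t (Suc k) *\<^sub>R (x (Suc k) - x k))
          = x (Suc k) + t (Suc k) *\<^sub>R (x (Suc k) - x k)"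
        using zero k by (intro subvec_Union[OF part]) (simp add: subvec_simps)
      then show ?thesis
        using step[of "Suc k"] const[of "Suc k"] fix_thr[of "Suc k"] fix_thr[of k] k by simp
    qed
  qed
qed

section \<open>The energy along iterates with a fixed support\<close>

context
  fixes A :: "real^'n^'m" and b :: "real^'m" and \<alpha> p :: real and \<psi> :: "real \<Rightarrow> real"
    and G :: "'n set set"
  assumes \<alpha>: "0 < \<alpha>" and p: "1 \<le> p" and adm: "admissible_penalty \<psi>"
    and part: "partition_on UNIV G"
begin

abbreviation "grad v \<equiv> transpose A *v (A *v v - b)"

text \<open>All other terms are nonnegative, so every penalty value is at most
  \<open>M / \<alpha>\<close>, and coercivity bounds the group norms.\<close>

lemma bounded_energy_sublevel: "bounded {x. energy A b \<alpha> p \<psi> G x \<le> M}"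
proof -
  have "filterlim \<psi> at_top at_top" using adm by (simp add: admissible_penalty_def)
  then have "eventually (\<lambda>s. M / \<alpha> + 1 \<le> \<psi> s) at_top" by (simp add: filterlim_at_top)
  then obtain R where R: "\<And>s. s \<ge> R \<Longrightarrow> M / \<alpha> + 1 \<le> \<psi> s" by (auto simp: eventually_at_top_linorder)
  have "norm x \<le> real CARD('n) * R" if E: "energy A b \<alpha> p \<psi> G x \<le> M" for x
  proof -
    have "\<bar>x $ i\<bar> \<le> R" for i
    proof -
      have "i \<in> \<Union>G" using partition_onD1[OF part] by simp
      then obtain g where g: "g \<in> G" "i \<in> g" by blast
      have "\<psi> (lp_norm p (subvec g x)) \<le> (\<Sum>g\<in>G. \<psi> (lp_norm p (subvec g x)))"
        using g by (intro member_le_sum penalty_nonneg[OF adm] finite)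
      then have "\<alpha> * \<psi> (lp_norm p (subvec g x)) \<le> \<alpha> * (\<Sum>g\<in>G. \<psi> (lp_norm p (subvec g x)))"
        using \<alpha> by simp
      also have "\<dots> \<le> 1/2 * (norm (A *v x - b))\<^sup>2 + \<dots>" by simp
      also have "\<dots> \<le> M" using E by (simp add: energy_def)
      finally have "\<psi> (lp_norm p (subvec g x)) < M / \<alpha> + 1"
        using \<alpha> by (simp add: field_simps)
      then have "lp_norm p (subvec g x) < R" using R[of "lp_norm p (subvec g x)"] by linarith
      moreover have "\<bar>x $ i\<bar> \<le> lp_norm p (subvec g x)"
        using component_le_lp_norm[OF p, of "subvec g x" i] g by (simp add: subvec_def)
      ultimately show ?thesis by simp
    qed
    then have "(\<Sum>i\<in>UNIV. \<bar>x $ i\<bar>) \<le> real CARD('n) * R" by (intro sum_bounded_above)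
    then show ?thesis using norm_le_l1_cart[of x] by linarith
  qed
  then show ?thesis by (auto simp: bounded_iff)
qed

text \<open>The bound \<open>\<tau>\<close> is needed because \<open>\<psi>\<close> may be discontinuous at \<open>0\<close>.\<close>

lemma tendsto_energy:
  assumes u: "u \<longlonglongrightarrow> l" and "S \<subseteq> G" and \<tau>: "0 < \<tau>"
    and act: "\<And>j g. g \<in> S \<Longrightarrow> \<tau> \<le> lp_norm p (subvec g (u j))"
    and inact: "\<And>j g. g \<in> G - S \<Longrightarrow> subvec g (u j) = 0"
  shows "(\<lambda>j. energy A b \<alpha> p \<psi> G (u j)) \<longlonglongrightarrow> energy A b \<alpha> p \<psi> G l"
proof -
  have "(\<lambda>j. \<psi> (lp_norm p (subvec g (u j)))) \<longlonglongrightarrow> \<psi> (lp_norm p (subvec g l))" if "g \<in> G" for g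
  proof (cases "g \<in> S")
    case True
    have lim: "(\<lambda>j. lp_norm p (subvec g (u j))) \<longlonglongrightarrow> lp_norm p (subvec g l)"
      by (intro tendsto_lp_norm tendsto_subvec u p)
    then have "\<tau> \<le> lp_norm p (subvec g l)" by (rule LIMSEQ_le_const) (use act True in blast)
    then have "isCont \<psi> (lp_norm p (subvec g l))"
      using adm \<tau> by (auto simp: admissible_penalty_def intro: differentiable_imp_continuous_within)
    then show ?thesis using lim by (rule isCont_tendsto_compose)
  next
    case False
    have "(\<lambda>j. subvec g (u j)) \<longlonglongrightarrow> subvec g l" by (intro tendsto_subvec u)
    then have "subvec g l = 0" using inact[of g] False that by (simp add: LIMSEQ_const_iff)
    then show ?thesis using inact[of g] False that by simp
  qed
  moreover have "(\<lambda>j. A *v u j) \<longlonglongrightarrow> A *v l"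
    using matrix_vector_mul_bounded_linear u by (rule bounded_linear.tendsto)
  ultimately show ?thesis unfolding energy_def by (intro tendsto_intros)
qed

section \<open>One inexact step; \<open>xm\<close>, \<open>xk\<close>, \<open>xn\<close> are the
  previous, current and new iterates\<close>

context
  fixes \<beta> \<epsilon> s :: real and S :: "'n set set" and xm xk xn z :: "real^'n" and l :: "'n set \<Rightarrow> real^'n"
  assumes \<epsilon>: "0 \<le> \<epsilon>" "\<epsilon> < 1" and s: "0 \<le> s" "s \<le> 1"
    and \<beta>: "spectral_norm (transpose A ** A) < \<beta>"
    and z: "z = xk + s *\<^sub>R (xk - xm)"
    and S: "S \<subseteq> G"
    and act: "\<And>g. g \<in> S \<Longrightarrow> 0 < lp_norm p (subvec g xk)"
    and inact: "\<And>g. g \<in> G - S \<Longrightarrow> subvec g xk = 0" "\<And>g. g \<in> G - S \<Longrightarrow> subvec g xn = 0"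
    and l: "\<And>g. g \<in> S \<Longrightarrow> l g \<in> limiting_subdiff_on (coord_space g)
      (\<lambda>w. ereal (subproblem A b \<alpha> p \<psi> \<beta> xk z g w)) (subvec g xn)"
    and l_norm: "\<And>g. g \<in> S \<Longrightarrow> norm (l g) \<le> \<beta> * \<epsilon> / 2 * norm (subvec g xn - subvec g xk)"
begin

abbreviation "weight g \<equiv> \<alpha> * deriv \<psi> (lp_norm p (subvec g xk))"

text \<open>The residual minus the gradient of the quadratic part: what the optimality condition
  leaves for the weighted norm.\<close>

abbreviation "slope g \<equiv> l g - subvec g (grad z) - \<beta> *\<^sub>R (subvec g xn - subvec g z)"

lemma weight_pos: "g \<in> S \<Longrightarrow> 0 < weight g"
  using \<alpha> penalty_deriv_pos[OF adm act] by simp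

lemma beta_pos: "0 < \<beta>"
proof -
  have "0 \<le> spectral_norm (transpose A ** A)"
    unfolding spectral_norm_def by (intro onorm_pos_le matrix_vector_mul_bounded_linear)
  then show ?thesis using \<beta> by linarith
qed

text \<open>Apart from constants the subproblem is a quadratic plus \<open>weight g\<close> times
  the \<open>p\<close>-norm; the positive weight makes this second part convex, and \<open>h\<close>
  collects it.\<close>

lemma slope_subgradient:
  assumes g: "g \<in> S" and w: "w \<in> coord_space g"
  shows "weight g * lp_norm p (subvec g xn) + slope g \<bullet> (w - subvec g xn) \<le> weight g * lp_norm p w"
proof -
  define h where "h w = \<alpha> * (\<psi> (lp_norm p (subvec g xk))
    + deriv \<psi> (lp_norm p (subvec g xk)) * (lp_norm p w
      - lp_norm p (subvec g xk)))" for w :: "real^'n"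
  have h: "h w = \<alpha> * (\<psi> (lp_norm p (subvec g xk))
      - deriv \<psi> (lp_norm p (subvec g xk)) * lp_norm p (subvec g xk)) + weight g * lp_norm p w" for w
    by (simp add: h_def algebra_simps)
  have "convex_on UNIV h"
    unfolding h using weight_pos[OF g]
    by (intro convex_on_add convex_on_cmul convex_on_lp_norm p)
      (use \<alpha> in \<open>auto simp: convex_on_const\<close>)
  then have "convex_on (coord_space g) h"
    by (rule convex_on_subset) (auto intro: subspace_imp_convex subspace_coord_space)
  moreover have "continuous_on UNIV h"
    unfolding h continuous_on_def by (auto intro!: tendsto_intros tendsto_lp_norm p)
  moreover have "l g \<in> limiting_subdiff_on (coord_space g)
      (\<lambda>w. ereal ((w - subvec g z) \<bullet> subvec g (grad z) + \<beta> / 2 * (norm (w - subvec g z))\<^sup>2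
        + h w)) (subvec g xn)"
    using l[OF g] by (simp only: subproblem_def h_def)
  ultimately have "h (subvec g xn) + slope g \<bullet> (w - subvec g xn) \<le> h w"
    by (rule limiting_subgradient_quadratic_plus_convex[OF subspace_coord_space _ _ _ w])
  then show ?thesis by (simp add: h)
qed

text \<open>The weighted norm majorises the concave penalty by tangency at \<open>xk\<close>.
  Testing its subgradient inequality at \<open>xk\<close> makes \<open>grad z\<close> cancel against
  the expansion of the quadratic term about \<open>z\<close>, and only squares and the cross term of
  \<open>D\<close> and \<open>d\<close> remain.\<close>

lemma energy_step:
  defines "L \<equiv> spectral_norm (transpose A ** A)"
  shows "energy A b \<alpha> p \<psi> G xn + (\<beta> * (1 - \<epsilon>) + (\<beta> - L) * (1 - s)) / 2 * (norm (xn - xk))\<^sup>2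
    \<le> energy A b \<alpha> p \<psi> G xk + (L * s\<^sup>2 + (\<beta> - L) * s) / 2 * (norm (xk - xm))\<^sup>2"
proof -
  define D where "D = xn - xk"
  define d where "d = xk - xm"
  have pen: "\<alpha> * \<psi> (lp_norm p (subvec g xn)) - \<alpha> * \<psi> (lp_norm p (subvec g xk))
      \<le> \<beta> * \<epsilon> / 2 * (subvec g D \<bullet> subvec g D) - subvec g (grad z) \<bullet> subvec g D
        - \<beta> * (subvec g (xn - z) \<bullet> subvec g D)" if "g \<in> G" for g
  proof (cases "g \<in> S")
    case True
    have Dg: "subvec g D = subvec g xn - subvec g xk" by (simp add: D_def subvec_simps)
    have "\<psi> (lp_norm p (subvec g xn)) \<le> \<psi> (lp_norm p (subvec g xk))
        + deriv \<psi> (lp_norm p (subvec g xk)) * (lp_norm p (subvec g xn) - lp_norm p (subvec g xk))"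
      by (intro penalty_tangent[OF adm] act True lp_norm_nonneg)
    from mult_left_mono[OF this less_imp_le[OF \<alpha>]]
    have "\<alpha> * \<psi> (lp_norm p (subvec g xn)) - \<alpha> * \<psi> (lp_norm p (subvec g xk))
        \<le> weight g * lp_norm p (subvec g xn) - weight g * lp_norm p (subvec g xk)"
      by (simp add: algebra_simps)
    also have "\<dots> \<le> - (slope g \<bullet> (subvec g xk - subvec g xn))"
      using slope_subgradient[OF True, of "subvec g xk"] by simp
    also have "\<dots> = slope g \<bullet> subvec g D" by (simp add: Dg inner_diff_right)
    also have "\<dots> = l g \<bullet> subvec g D - subvec g (grad z) \<bullet> subvec g D - \<beta> * (subvec g (xn
      - z) \<bullet> subvec g D)"
      by (simp add: inner_diff_left subvec_simps)
    also have "l g \<bullet> subvec g D \<le> norm (l g) * norm (subvec g D)" by (rule norm_cauchy_schwarz)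
    also have "\<dots> \<le> (\<beta> * \<epsilon> / 2 * norm (subvec g D)) * norm (subvec g D)"
      using l_norm[OF True] unfolding Dg by (intro mult_right_mono) auto
    also have "\<dots> = \<beta> * \<epsilon> / 2 * (subvec g D \<bullet> subvec g D)"
      by (simp add: dot_square_norm power2_eq_square)
    finally show ?thesis by simp
  next
    case False
    then have "subvec g D = 0" "subvec g xn = subvec g xk"
      using inact[of g] that by (auto simp: D_def subvec_simps)
    then show ?thesis by simp
  qed
  have "\<alpha> * (\<Sum>g\<in>G. \<psi> (lp_norm p (subvec g xn))) - \<alpha> * (\<Sum>g\<in>G. \<psi> (lp_norm p (subvec g xk)))
      = (\<Sum>g\<in>G. \<alpha> * \<psi> (lp_norm p (subvec g xn)) - \<alpha> * \<psi> (lp_norm p (subvec g xk)))"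
    by (simp add: sum_distrib_left sum_subtractf)
  also have "\<dots> \<le> (\<Sum>g\<in>G. \<beta> * \<epsilon> / 2 * (subvec g D \<bullet> subvec g D) - subvec g (grad z) \<bullet> subvec g D
        - \<beta> * (subvec g (xn - z) \<bullet> subvec g D))"
    by (intro sum_mono pen)
  also have "\<dots> = \<beta> * \<epsilon> / 2 * (D \<bullet> D) - grad z \<bullet> D - \<beta> * ((xn - z) \<bullet> D)"
    by (simp add: sum_subtractf sum_inner_subvec_partition[OF part] flip: sum_distrib_left sum_divide_distrib
      del: transpose_matrix_vector)
  finally have P: "\<alpha> * (\<Sum>g\<in>G. \<psi> (lp_norm p (subvec g xn))) - \<alpha> * (\<Sum>g\<in>G. \<psi> (lp_norm p (subvec g xk)))
      \<le> \<beta> * \<epsilon> / 2 * (D \<bullet> D) - grad z \<bullet> D - \<beta> * ((xn - z) \<bullet> D)" .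
  have "1/2 * (norm (A *v xn - b))\<^sup>2 - 1/2 * (norm (A *v xk - b))\<^sup>2
      = grad z \<bullet> D + 1/2 * (norm (A *v (xn - z)))\<^sup>2 - 1/2 * (norm (A *v (xk - z)))\<^sup>2"
  proof -
    have "grad z \<bullet> (xn - z) - grad z \<bullet> (xk - z) = grad z \<bullet> D"
      by (simp add: D_def inner_diff_right del: transpose_matrix_vector)
    then show ?thesis
      using half_norm_expansion[of A xn b z] half_norm_expansion[of A xk b z] by linarith
  qed
  also have "\<dots> \<le> grad z \<bullet> D + 1/2 * (L * ((xn - z) \<bullet> (xn - z)))"
  proof -
    have "(norm (A *v (xn - z)))\<^sup>2 \<le> L * ((xn - z) \<bullet> (xn - z))"
      using norm_matrix_vector_le_gram[of A "xn - z"] by (simp add: L_def power2_norm_eq_inner)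
    moreover have "0 \<le> (norm (A *v (xk - z)))\<^sup>2" by simp
    ultimately show ?thesis by linarith
  qed
  finally have Q: "1/2 * (norm (A *v xn - b))\<^sup>2 - 1/2 * (norm (A *v xk - b))\<^sup>2
      \<le> grad z \<bullet> D + 1/2 * (L * ((xn - z) \<bullet> (xn - z)))" .
  have xz: "xn - z = D - s *\<^sub>R d" by (simp add: z D_def d_def)
  have e1: "(xn - z) \<bullet> (xn - z) = D \<bullet> D - 2 * s * (d \<bullet> D) + s\<^sup>2 * (d \<bullet> d)"
    unfolding xz by (simp add: inner_diff inner_commute power2_eq_square algebra_simps)
  have e2: "(xn - z) \<bullet> D = D \<bullet> D - s * (d \<bullet> D)"
    unfolding xz by (simp add: inner_diff_left)
  \<comment> \<open>Young's inequality for the cross term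
    \<open>(\<beta> - L) * s * (d \<bullet> D)\<close>; it charges
    \<open>(\<beta> - L) * s / 2\<close> to each of the two squares.\<close>
  have "0 \<le> (D - d) \<bullet> (D - d)" by simp
  then have "2 * (d \<bullet> D) \<le> D \<bullet> D + d \<bullet> d" by (simp add: inner_diff inner_commute)
  then have "(\<beta> - L) * s / 2 * (2 * (d \<bullet> D)) \<le> (\<beta> - L) * s / 2 * (D \<bullet> D + d \<bullet> d)"
    using s \<beta> by (intro mult_left_mono) (auto simp: L_def)
  then show ?thesis
    using P Q unfolding energy_def e1 e2 D_def[symmetric] d_def[symmetric] power2_norm_eq_inner[of D]
      power2_norm_eq_inner[of d]
    by (simp add: field_simps del: transpose_matrix_vector)
qed

text \<open>Each active group contributes \<open>L\<close> for moving the gradient from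
  \<open>z\<close> to \<open>xn\<close>, one \<open>\<beta>\<close> for the residual, one for the
  proximal term, and \<open>\<alpha> * K * q\<^sup>2\<close> for updating the weight. Inactive
  groups contribute nothing.\<close>

lemma energy_subgradient:
  fixes K \<tau> :: real
  defines "L \<equiv> spectral_norm (transpose A ** A)" and "q \<equiv> real CARD('n) powr (1 / p)"
  assumes \<tau>: "0 < \<tau>" "\<And>g. g \<in> S \<Longrightarrow> \<tau> \<le> lp_norm p (subvec g xk)" "\<And>g. g \<in> S \<Longrightarrow> \<tau>
    \<le> lp_norm p (subvec g xn)"
    and K: "0 \<le> K" "\<And>c d. \<tau> \<le> c \<Longrightarrow> \<tau> \<le> d \<Longrightarrow> \<bar>deriv \<psi> c - deriv \<psi> d\<bar> \<le> K * \<bar>c - d\<bar>"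
  shows "\<exists>v. frechet_minorant (energy A b \<alpha> p \<psi> G) xn v \<and>
    norm v \<le> real (card G) * (L + 2 * \<beta> + \<alpha> * K * q\<^sup>2) * (norm (xn - xk) + norm (xk - xm))"
proof -
  define M where "M = L + 2 * \<beta> + \<alpha> * K * q\<^sup>2"
  define R where "R = norm (xn - xk) + norm (xk - xm)"
  \<comment> \<open>Dividing by the weight at \<open>xk\<close> leaves a subgradient of the bare
    norm at \<open>xn\<close>, which can be rescaled with the weight at \<open>xn\<close>.\<close>
  define \<nu> where "\<nu> g = (1 / weight g) *\<^sub>R slope g" for g
  \<comment> \<open>On inactive groups the subgradient is free and is chosen to cancel the
    gradient.\<close>
  define e where "e g = (if g \<in> S then (\<alpha> * deriv \<psi> (lp_norm p (subvec g xn))) *\<^sub>R \<nu> g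
    else - subvec g (grad xn))" for g
  define v where "v = grad xn + (\<Sum>g\<in>G. e g)"
  have q: "0 < q" by (simp add: q_def)
  have L0: "0 \<le> L"
    unfolding L_def spectral_norm_def by (intro onorm_pos_le matrix_vector_mul_bounded_linear)
  have M0: "0 \<le> M" using L0 beta_pos \<alpha> K(1) by (simp add: M_def)
  have R0: "0 \<le> R" by (simp add: R_def)
  have \<nu>_in: "\<nu> g \<in> coord_space g" if "g \<in> S" for g
  proof -
    have "l g \<in> coord_space g" using l[OF that] by (simp add: limiting_subdiff_on_def)
    then show ?thesis
      unfolding \<nu>_def by (intro subspace_scale subspace_diff subspace_coord_space) simp_all
  qed
  have \<nu>: "lp_norm p (subvec g xn) + \<nu> g \<bullet> (w - subvec g xn) \<le> lp_norm p w"
    if "g \<in> S" "w \<in> coord_space g" for g w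
  proof -
    have "weight g * (lp_norm p (subvec g xn) + \<nu> g \<bullet> (w - subvec g xn)) \<le> weight g * lp_norm p w"
      using slope_subgradient[OF that] weight_pos[OF that(1)] by (simp add: \<nu>_def distrib_left)
    then show ?thesis using weight_pos[OF that(1)] by (simp only: mult_le_cancel_left_pos)
  qed
  \<comment> \<open>A subgradient of a \<open>q\<close>-Lipschitz function has norm at most
    \<open>q\<close>; the test point is \<open>subvec g xn + \<nu> g\<close>.\<close>
  have \<nu>_norm: "norm (\<nu> g) \<le> q" if "g \<in> S" for g
  proof (cases "\<nu> g = 0")
    case False
    have "\<nu> g \<bullet> \<nu> g \<le> lp_norm p (subvec g xn + \<nu> g) - lp_norm p (subvec g xn)"
      using \<nu>[OF that, of "subvec g xn + \<nu> g"] \<nu>_in[OF that]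
      by (simp add: subspace_add subspace_coord_space)
    also have "\<dots> \<le> q * norm (\<nu> g)"
      using lp_norm_diff_le[OF p, of "subvec g xn + \<nu> g" "subvec g xn"] by (simp add: q_def)
    finally show ?thesis using False by (simp add: dot_square_norm power2_eq_square)
  qed (use q in simp)
  have min_e: "frechet_minorant (\<lambda>y. \<alpha> * \<psi> (lp_norm p (subvec g y))) xn (e g)" if g: "g \<in> G" for g
  proof (cases "g \<in> S")
    case True
    have "subvec g xn \<noteq> 0" using \<tau>(1) \<tau>(3)[OF True] by auto
    then show ?thesis
      using frechet_minorant_penalty_nonzero[OF adm p \<alpha> _ \<nu>_in[OF True] \<nu>[OF True]] True
      by (simp add: e_def)
  next
    case False
    then have "subvec g xn = 0" using inact g by simp
    moreover have "- subvec g (grad xn) \<in> coord_space g"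
      by (intro subspace_neg subspace_coord_space subvec_in_coord_space)
    ultimately show ?thesis
      using frechet_minorant_penalty_zero[OF adm p \<alpha>, of g xn "- subvec g (grad xn)"] False
        by (simp only: e_def if_False)
  qed
  have "frechet_minorant (\<lambda>y. 1/2 * (norm (A *v y - b))\<^sup>2) xn (grad xn)"
  proof (rule frechet_minorant_global)
    fix y
    have "0 \<le> 1/2 * (norm (A *v (y - xn)))\<^sup>2" by simp
    then show "grad xn \<bullet> (y - xn) \<le> 1/2 * (norm (A *v y - b))\<^sup>2 - 1/2 * (norm (A *v xn - b))\<^sup>2"
      using half_norm_expansion[of A y b xn] by linarith
  qed
  from frechet_minorant_add[OF this frechet_minorant_sum[OF finite min_e]]
  have min_v: "frechet_minorant (energy A b \<alpha> p \<psi> G) xn v"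
    by (simp add: v_def energy_def[abs_def] sum_distrib_left del: transpose_matrix_vector)
  have xz: "norm (xn - z) \<le> R"
  proof -
    have e: "xn - z = (xn - xk) - s *\<^sub>R (xk - xm)" by (simp add: z)
    have "norm (xn - z) \<le> norm (xn - xk) + norm (s *\<^sub>R (xk - xm))"
      unfolding e by (rule norm_triangle_ineq4)
    moreover have "norm (s *\<^sub>R (xk - xm)) \<le> norm (xk - xm)"
      using s by (simp add: mult_left_le_one_le)
    ultimately show ?thesis by (simp add: R_def)
  qed
  have bound: "norm (subvec g (grad xn) + e g) \<le> M * R" if g: "g \<in> G" for g
  proof (cases "g \<in> S")
    case True
    \<comment> \<open>The change of weight between \<open>xk\<close> and \<open>xn\<close>; both
      norms are at least \<open>\<tau>\<close>, so the Lipschitz bound on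
      \<open>deriv \<psi>\<close> applies.\<close>
    define \<kappa> where "\<kappa> = \<alpha> * (deriv \<psi> (lp_norm p (subvec g xn)) - deriv \<psi> (lp_norm p (subvec g xk)))"
    have "grad xn - grad z = (transpose A ** A) *v (xn - z)"
      by (simp add: matrix_vector_mult_diff_distrib flip: matrix_vector_mul_assoc del: transpose_matrix_vector)
    moreover have "norm ((transpose A ** A) *v (xn - z)) \<le> L * norm (xn - z)"
      unfolding L_def spectral_norm_def by (intro onorm matrix_vector_mul_bounded_linear)
    ultimately have 1: "norm (subvec g (grad xn - grad z)) \<le> L * R"
      using norm_subvec_le[of g "grad xn - grad z"] mult_left_mono[OF xz L0] by simp
    have Dg: "norm (subvec g xn - subvec g xk) \<le> R"
      using norm_subvec_le[of g "xn - xk"] by (simp add: subvec_simps R_def add_increasing2)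
    have "norm (l g) \<le> \<beta> * \<epsilon> / 2 * norm (subvec g xn - subvec g xk)" by (rule l_norm[OF True])
    also have "\<dots> \<le> \<beta> * R"
      using Dg beta_pos \<epsilon> by (intro mult_mono) auto
    finally have 2: "norm (l g) \<le> \<beta> * R" .
    have "norm (\<beta> *\<^sub>R subvec g (xn - z)) \<le> \<beta> * norm (xn - z)"
      using beta_pos norm_subvec_le[of g "xn - z"] by simp
    also have "\<dots> \<le> \<beta> * R" using beta_pos xz by simp
    finally have 3: "norm (\<beta> *\<^sub>R subvec g (xn - z)) \<le> \<beta> * R" .
    have "\<bar>lp_norm p (subvec g xn) - lp_norm p (subvec g xk)\<bar> \<le> q * R"
      using order_trans[OF lp_norm_diff_le[OF p] mult_left_mono[OF Dg]] q by (simp add: q_def)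
    then have "\<bar>deriv \<psi> (lp_norm p (subvec g xn)) - deriv \<psi> (lp_norm p (subvec g xk))\<bar>
      \<le> K * (q * R)"
      using K(2)[OF \<tau>(3)[OF True] \<tau>(2)[OF True]] K(1) by (meson mult_left_mono order_trans)
    then have "\<bar>\<kappa>\<bar> \<le> \<alpha> * (K * (q * R))" using \<alpha> by (simp add: \<kappa>_def abs_mult)
    then have 4: "norm (\<kappa> *\<^sub>R \<nu> g) \<le> \<alpha> * K * q\<^sup>2 * R"
      using mult_mono[OF _ \<nu>_norm[OF True], of "\<bar>\<kappa>\<bar>" "\<alpha> * (K * (q * R))"] \<alpha> K(1) q R0
      by (simp add: power2_eq_square mult_ac)
    have "weight g * (1 / weight g) = 1"
      using weight_pos[OF True] by (metis divide_self less_irrefl mult.right_neutral times_divide_eq_right)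
    then have slope: "weight g *\<^sub>R \<nu> g = slope g"
      unfolding \<nu>_def scaleR_scaleR by (simp only: scaleR_one)
    have "\<alpha> * deriv \<psi> (lp_norm p (subvec g xn)) = \<kappa> + weight g"
      by (simp add: \<kappa>_def right_diff_distrib)
    then have "e g = \<kappa> *\<^sub>R \<nu> g + slope g"
      using True by (simp only: e_def if_True scaleR_add_left slope)
    then have "subvec g (grad xn) + e g
        = subvec g (grad xn - grad z) + l g - \<beta> *\<^sub>R subvec g (xn - z) + \<kappa> *\<^sub>R \<nu> g"
      by (simp add: subvec_simps del: transpose_matrix_vector)
    also have "norm \<dots> \<le> norm (subvec g (grad xn - grad z)) + norm (l g)
        + norm (\<beta> *\<^sub>R subvec g (xn - z)) + norm (\<kappa> *\<^sub>R \<nu> g)"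
      using norm_triangle_ineq[of "subvec g (grad xn - grad z)
        + l g - \<beta> *\<^sub>R subvec g (xn - z)" "\<kappa> *\<^sub>R \<nu> g"]
        norm_triangle_ineq4[of "subvec g (grad xn - grad z) + l g" "\<beta> *\<^sub>R subvec g (xn - z)"]
        norm_triangle_ineq[of "subvec g (grad xn - grad z)" "l g"] by linarith
    also have "\<dots> \<le> M * R" using 1 2 3 4 by (simp add: M_def distrib_right)
    finally show ?thesis .
  next
    case False
    then show ?thesis using M0 R0 by (simp add: e_def)
  qed
  have "v = (\<Sum>g\<in>G. subvec g (grad xn) + e g)"
    by (simp add: v_def sum.distrib sum_subvec_partition[OF part] del: transpose_matrix_vector)
  then have "norm v \<le> (\<Sum>g\<in>G. norm (subvec g (grad xn) + e g))" by (simp only: norm_sum)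
  also have "\<dots> \<le> real (card G) * (M * R)" by (intro sum_bounded_above bound)
  finally have "norm v \<le> real (card G) * M * R" by simp
  then show ?thesis using min_v unfolding M_def R_def by blast
qed

end

end

theorem theorem4p5:
  fixes A :: "real^('n::{finite,linorder})^('m::finite)"
    and b :: "real^'m"
    and \<alpha> p \<beta> \<tau> \<epsilon> :: real
    and \<psi> :: "real \<Rightarrow> real"
    and G :: "'n set set"
    and t :: "nat \<Rightarrow> real"
    and x :: "nat \<Rightarrow> real^('n::{finite,linorder})"
  assumes "CARD('m) < CARD('n)"
    and "A \<noteq> 0"
    and "b \<noteq> 0"
    and "\<alpha> > 0"
    and "p \<ge> 1"
    and "consecutive_partition G"
    and "admissible_penalty \<psi>"
    and "\<beta> > spectral_norm (transpose A ** A)"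
    and "\<tau> > 0"
    and "0 \<le> \<epsilon>" and "\<epsilon> < 1"
    and "\<forall>k. 0 \<le> t k \<and> t k < t_bar A \<beta> \<epsilon>"
    and "(SUP k. t k) < t_bar A \<beta> \<epsilon>"
    and "FITS3_sequence A b \<alpha> p \<psi> G \<beta> \<tau> \<epsilon> t x"
    and "KL_function (\<lambda>(v, u). ereal (energy A b \<alpha> p \<psi> G v + \<beta> * (1 - \<epsilon>) / 2 * (norm (v - u))\<^sup>2))"
  shows "(\<exists>xbar. x \<longlonglongrightarrow> xbar \<and>
            0 \<in> limiting_subdiff (\<lambda>v. ereal (energy A b \<alpha> p \<psi> G v)) xbar)
         \<and> summable (\<lambda>k. norm (x k - (if k = 0 then x 0 else x (k - 1))))"
proof -
  note \<alpha> = assms(4) and p = assms(5) and adm = assms(7) and \<beta> = assms(8) and \<tau> = assms(9)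
    and \<epsilon> = assms(10,11)
  define L where "L = spectral_norm (transpose A ** A)"
  define E where "E = energy A b \<alpha> p \<psi> G"
  have part: "partition_on UNIV G" using assms(6) by (simp add: consecutive_partition_def)
  have L: "0 < L" "L < \<beta>" using spectral_norm_gram_pos[OF assms(2)] \<beta> by (auto simp: L_def)
  obtain N S where S: "S \<subseteq> G"
    and act: "\<And>k g. N \<le> k \<Longrightarrow> g \<in> S \<Longrightarrow> \<tau> \<le> lp_norm p (subvec g (x k))"
    and inact: "\<And>k g. N \<le> k \<Longrightarrow> g \<in> G - S \<Longrightarrow> subvec g (x k) = 0"
    and sub: "\<And>k g. N \<le> k \<Longrightarrow> g \<in> S \<Longrightarrow>
      \<exists>l\<in>limiting_subdiff_on (coord_space g)
          (\<lambda>w. ereal (subproblem A b \<alpha> p \<psi> \<beta> (x (Suc k))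
             (x (Suc k) + t (Suc k) *\<^sub>R (x (Suc k) - x k)) g w)) (subvec g (x (Suc (Suc k)))).
        norm l \<le> \<beta> * \<epsilon> / 2 * norm (subvec g (x (Suc (Suc k))) - subvec g (x (Suc k)))"
    by (rule FITS3_support_stabilizes[OF part \<tau> assms(14)]) (rule that)
  define T where "T = (SUP k. t k)"
  have "bdd_above (range t)" using assms(12) by (auto simp: bdd_above_def intro: less_imp_le)
  then have t_le: "t k \<le> T" for k unfolding T_def by (rule cSUP_upper[OF UNIV_I])
  have t0: "0 \<le> t k" for k using assms(12) by simp
  then have T0: "0 \<le> T" using t_le order_trans by blast
  have T: "L * T\<^sup>2 + (\<beta> - L) * T < \<beta> * (1 - \<epsilon>)" "T < 1"
    using t_bar_bounds[of A \<beta> \<epsilon> T] L \<epsilon> T0 assms(13) unfolding L_def T_def by auto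
  \<comment> \<open>The gap between the weight of the squared step in \<open>H\<close> and the
    largest coefficient of the older squared step in \<open>energy_step\<close>. Evaluating at the
    supremum \<open>T\<close> makes it independent of \<open>k\<close>.\<close>
  define c' where "c' = (\<beta> * (1 - \<epsilon>) - (L * T\<^sup>2 + (\<beta> - L) * T)) / 2"
  obtain K where K: "0 \<le> K"
    "\<And>c d. \<tau> \<le> c \<Longrightarrow> \<tau> \<le> d \<Longrightarrow> \<bar>deriv \<psi> c - deriv \<psi> d\<bar> \<le> K * \<bar>c - d\<bar>"
    by (rule penalty_deriv_lipschitz[OF adm \<tau>]) (rule that)
  define C where "C = real (card G) * (L + 2 * \<beta> + \<alpha> * K * (real CARD('n) powr (1 / p))\<^sup>2)"
  define y where "y k = x (k + N)" for k
  define d where "d k = norm (y (Suc k) - y k)" for k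
  have step: "E (y (Suc (Suc k))) + (\<beta> * (1 - \<epsilon>) + (\<beta> - L) * (1 - t (Suc (k
    + N)))) / 2 * (d (Suc k))\<^sup>2
      \<le> E (y (Suc k)) + (L * (t (Suc (k + N)))\<^sup>2 + (\<beta> - L) * t (Suc (k + N))) / 2 * (d k)\<^sup>2"
    and grad_step: "\<exists>v. frechet_minorant E (y (Suc (Suc k))) v \<and> norm v
      \<le> C * (d (Suc k) + d k)" for k
  proof -
    define n where "n = k + N"
    define z where "z = x (Suc n) + t (Suc n) *\<^sub>R (x (Suc n) - x n)"
    have n: "N \<le> n" "N \<le> Suc n" "N \<le> Suc (Suc n)" by (simp_all add: n_def)
    have t1: "t (Suc n) \<le> 1" using t_le[of "Suc n"] T(2) by linarith
    obtain l where l: "\<And>g. g \<in> S \<Longrightarrow> l g \<in> limiting_subdiff_on (coord_space g)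
          (\<lambda>w. ereal (subproblem A b \<alpha> p \<psi> \<beta> (x (Suc n)) z g w)) (subvec g (x (Suc (Suc n))))"
        "\<And>g. g \<in> S \<Longrightarrow> norm (l g) \<le> \<beta> * \<epsilon> / 2 * norm (subvec g (x (Suc (Suc n)))
          - subvec g (x (Suc n)))"
      using sub[OF n(1)] unfolding z_def[symmetric] by metis
    have pos: "0 < lp_norm p (subvec g (x (Suc n)))" if "g \<in> S" for g
      using act[OF n(2) that] \<tau> by linarith
    note prems = \<alpha> p adm part \<epsilon> t0[of "Suc n"] t1 \<beta> z_def S pos inact[OF n(2)] inact[OF n(3)] l
    show "E (y (Suc (Suc k))) + (\<beta> * (1 - \<epsilon>) + (\<beta> - L) * (1 - t (Suc (k + N)))) / 2 * (d (Suc k))\<^sup>2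
      \<le> E (y (Suc k)) + (L * (t (Suc (k + N)))\<^sup>2 + (\<beta> - L) * t (Suc (k + N))) / 2 * (d k)\<^sup>2"
      using energy_step[OF prems] by (simp only: E_def L_def d_def y_def n_def add_Suc)
    show "\<exists>v. frechet_minorant E (y (Suc (Suc k))) v \<and> norm v \<le> C * (d (Suc k) + d k)"
      using energy_subgradient[OF prems \<tau> act[OF n(2)] act[OF n(3)] K]
      by (simp only: E_def C_def L_def d_def y_def n_def add_Suc)
  qed
  from grad_step obtain v where v: "\<And>k. frechet_minorant E (y (Suc (Suc k))) (v k)"
    "\<And>k. norm (v k) \<le> C * (d (Suc k) + d k)" by metis
  have C: "0 < C"
  proof -
    have "G \<noteq> {}" using partition_onD1[OF part] by auto
    then have "0 < card G" by (simp add: card_gt_0_iff)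
    moreover have "0 \<le> \<alpha> * K * (real CARD('n) powr (1 / p))\<^sup>2" using \<alpha> K(1) by simp
    ultimately show ?thesis unfolding C_def using L by (intro mult_pos_pos) auto
  qed
  have descent: "E (y (Suc (Suc k))) + \<beta> * (1 - \<epsilon>) / 2 * (d (Suc k))\<^sup>2 + c' * (d k)\<^sup>2
      \<le> E (y (Suc k)) + \<beta> * (1 - \<epsilon>) / 2 * (d k)\<^sup>2" for k
  proof -
    define s where "s = t (Suc (k + N))"
    have s: "0 \<le> s" "s \<le> T" using t0 t_le by (auto simp: s_def)
    \<comment> \<open>This surplus on the new step is given away; the decrease that is kept sits on
      the older step \<open>d k\<close>.\<close>
    have "0 \<le> (\<beta> - L) * (1 - s) / 2 * (d (Suc k))\<^sup>2"
      using s T(2) L by (intro mult_nonneg_nonneg divide_nonneg_nonneg) auto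
    moreover have "L * s\<^sup>2 + (\<beta> - L) * s \<le> L * T\<^sup>2 + (\<beta> - L) * T"
      using s L by (intro add_mono mult_left_mono power_mono) auto
    then have "(L * s\<^sup>2 + (\<beta> - L) * s) / 2 * (d k)\<^sup>2 \<le> (L * T\<^sup>2 + (\<beta> - L) * T) / 2 * (d k)\<^sup>2"
      by (intro mult_right_mono) auto
    moreover have "(L * T\<^sup>2 + (\<beta> - L) * T) / 2 * (d k)\<^sup>2 = \<beta> * (1 - \<epsilon>) / 2 * (d k)\<^sup>2 - c' * (d k)\<^sup>2"
      by (simp add: c'_def field_simps)
    moreover have "(\<beta> * (1 - \<epsilon>) + (\<beta> - L) * (1 - s)) / 2 * (d (Suc k))\<^sup>2
        = \<beta> * (1 - \<epsilon>) / 2 * (d (Suc k))\<^sup>2 + (\<beta> - L) * (1 - s) / 2 * (d (Suc k))\<^sup>2"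
      by (simp add: field_simps)
    ultimately show ?thesis using step[of k] unfolding s_def[symmetric] by linarith
  qed
  \<comment> \<open>Points of the tail share the support \<open>S\<close> with active norms at least
    \<open>\<tau>\<close>, which excludes a jump of \<open>\<psi>\<close> at 0.\<close>
  have F_lim: "(\<lambda>j. E (u j)) \<longlonglongrightarrow> E l" if "\<And>j. u j \<in> range y" "u \<longlonglongrightarrow> l" for u l
    unfolding E_def
  proof (rule tendsto_energy[OF \<alpha> p adm part that(2) S \<tau>])
    show "\<tau> \<le> lp_norm p (subvec g (u j))" if "g \<in> S" for j g
    proof -
      obtain k where "u j = x (k + N)" using \<open>\<And>j. u j \<in> range y\<close>[of j] by (auto simp: y_def)
      then show ?thesis using act[OF _ that] by simp
    qed
    show "subvec g (u j) = 0" if "g \<in> G - S" for j g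
    proof -
      obtain k where "u j = x (k + N)" using \<open>\<And>j. u j \<in> range y\<close>[of j] by (auto simp: y_def)
      then show ?thesis using inact[OF _ that] by simp
    qed
  qed
  have c_pos: "0 < \<beta> * (1 - \<epsilon>)" "0 < c'" using L \<epsilon> T by (auto simp: c'_def)
  have E_nonneg: "0 \<le> E u" for u
    unfolding E_def energy_def using \<alpha> penalty_nonneg[OF adm]
    by (intro add_nonneg_nonneg mult_nonneg_nonneg sum_nonneg) auto
  have E_bdd: "bounded {u. E u \<le> M}" for M
    unfolding E_def by (rule bounded_energy_sublevel[OF \<alpha> p adm part])
  note main = KL_proximal_descent[where F = E and y = y and v = v and c = "\<beta> * (1 - \<epsilon>)" and c' = c',
      OF c_pos C E_nonneg E_bdd F_lim descent[unfolded d_def] v[unfolded d_def]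
      assms(15)[folded E_def]]
  have lim: "\<exists>ybar. y \<longlonglongrightarrow> ybar \<and> 0 \<in> limiting_subdiff (\<lambda>v. ereal (E v)) ybar"
    by (rule main(1))
  have sum: "summable (\<lambda>k. norm (y (Suc k) - y k))" by (rule main(2))
  have "summable (\<lambda>k. norm (x (Suc k) - x k))"
    using sum summable_iff_shift[of "\<lambda>k. norm (x (Suc k) - x k)" N] by (simp add: y_def)
  \<comment> \<open>The convention at \<open>k = 0\<close> merely prepends a zero term to the series
    of steps.\<close>
  then have "summable (\<lambda>k. norm (x k - (if k = 0 then x 0 else x (k - 1))))"
    by (subst summable_Suc_iff[symmetric]) simp
  moreover have "x \<longlonglongrightarrow> l \<longleftrightarrow> y \<longlonglongrightarrow> l" for l
    unfolding y_def[abs_def] using LIMSEQ_ignore_initial_segment LIMSEQ_offset by blast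
  ultimately show ?thesis using lim unfolding E_def by blast
qed

end
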